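(* Let $p,q\in\mathbb C$ with $p\neq0$ and consider the operator $P:\mathcal D'(\mathrm{SU}(2))\to\mathcal D'(\mathrm{SU}(2))$, $Pu:=\partial_0u-qu-p\bar u$. Then $P$ is globally hypoelliptic if and only if $\Delta(\ell)_m:=-m^2+|q|^2-|p|^2-2im\,\mathrm{Re}(q)\neq0$ for all $\ell\in\frac12\mathbb N_0$ and all $m$ with $-\ell\le m\le\ell$, $\ell-m\in\mathbb N_0$.
   Context: $\widehat{\mathrm{SU}(2)}$ consists of the classes of the standard irreducible unitary representations $\mathsf t^\ell:\mathrm{SU}(2)\to\mathbb C^{(2\ell+1)\times(2\ell+1)}$, $\ell\in\frac12\mathbb N_0$ (as in Ruzhansky–Turunen), with matrix entries $\mathsf t^\ell_{mn}$ indexed by $-\ell\le m,n\le\ell$, $\ell-m,\ell-n\in\mathbb N_0$. $\partial_0$ is the neutral left-invariant vector field, whose symbol in these representations is $\sigma_{\partial_0}(\ell)_{mn}=im\delta_{mn}$. For $u\in\mathcal D'$, $\bar u$ is defined by $\langle\bar u,\varphi\rangle=\overline{\langle u,\bar\varphi\rangle}$. $P$ is globally hypoelliptic if $u\in\mathcal D'(\mathrm{SU}(2))$ and $Pu\in C^\infty(\mathrm{SU}(2))$ imply $u\in C^\infty(\mathrm{SU}(2))$. *)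

theory Defs
  imports "HOL-Analysis.Analysis"
begin

type_synonym cmat = "complex ^ 2 ^ 2"

definition adj :: "cmat \<Rightarrow> cmat" where
  "adj U = (\<chi> i j. cnj (U $ j $ i))"

definition SU2 :: "cmat set" where
  "SU2 = {U. adj U ** U = mat 1 \<and> det U = 1}"

primrec Ck :: "nat \<Rightarrow> ('a::real_normed_vector \<Rightarrow> 'b::real_normed_vector) \<Rightarrow> bool" where
  "Ck 0 f = continuous_on UNIV f"
| "Ck (Suc k) f = ((\<forall>x. f differentiable (at x)) \<and>
                    (\<forall>v. Ck k (\<lambda>x. frechet_derivative f (at x) v)))"

definition smooth_amb :: "('a::real_normed_vector \<Rightarrow> 'b::real_normed_vector) \<Rightarrow> bool" where
  "smooth_amb f = (\<forall>k. Ck k f)"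

definition smooth_su2 :: "(cmat \<Rightarrow> complex) \<Rightarrow> bool" where
  "smooth_su2 \<phi> = (\<exists>g. smooth_amb g \<and> (\<forall>x\<in>SU2. g x = \<phi> x))"

text \<open>Basis Z_1, Z_2, Z_3 of su(2), Z_j = (i/2) sigma_j (Pauli matrices), and
  exp(t Z_j) = cos(t/2) I + 2 sin(t/2) Z_j (since Z_j^2 = -I/4).
  Z_3 = diag(i/2, -i/2) generates the maximal torus; it gives the neutral
  field partial_0.\<close>

definition Zb :: "nat \<Rightarrow> cmat" where
  "Zb j = (if j = 1 then (\<chi> a b. if a \<noteq> b then \<i>/2 else 0)
           else if j = 2 then (\<chi> a b. if a = 1 \<and> b = 2 then 1/2
                                    else if a = 2 \<and> b = 1 then -1/2 else 0)
           else (\<chi> a b. if a = b then (if a = 1 then \<i>/2 else -\<i>/2) else 0))"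

definition expZ :: "nat \<Rightarrow> real \<Rightarrow> cmat" where
  "expZ j t = (\<chi> a b. complex_of_real (cos (t/2)) * mat 1 $ a $ b
                 + complex_of_real (2 * sin (t/2)) * Zb j $ a $ b)"

definition lider :: "nat \<Rightarrow> (cmat \<Rightarrow> complex) \<Rightarrow> (cmat \<Rightarrow> complex)" where
  "lider j f x = vector_derivative (\<lambda>t::real. f (x ** expZ j t)) (at 0)"

abbreviation partial0 :: "(cmat \<Rightarrow> complex) \<Rightarrow> (cmat \<Rightarrow> complex)" where
  "partial0 \<equiv> lider 3"

fun liderw :: "nat list \<Rightarrow> (cmat \<Rightarrow> complex) \<Rightarrow> (cmat \<Rightarrow> complex)" where
  "liderw [] f = f"
| "liderw (j # w) f = lider j (liderw w f)"

definition seminorm_k :: "nat \<Rightarrow> (cmat \<Rightarrow> complex) \<Rightarrow> real" where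
  "seminorm_k k \<phi> = (\<Sum>w\<in>{w. length w \<le> k \<and> set w \<subseteq> {1,2,3}}.
                        (SUP x\<in>SU2. cmod (liderw w \<phi> x)))"

definition is_dist :: "((cmat \<Rightarrow> complex) \<Rightarrow> complex) \<Rightarrow> bool" where
  "is_dist u =
     ((\<forall>\<phi> \<psi> a b. smooth_su2 \<phi> \<longrightarrow> smooth_su2 \<psi> \<longrightarrow>
          u (\<lambda>x. a * \<phi> x + b * \<psi> x) = a * u \<phi> + b * u \<psi>) \<and>
      (\<exists>C k. \<forall>\<phi>. smooth_su2 \<phi> \<longrightarrow> cmod (u \<phi>) \<le> C * seminorm_k k \<phi>))"

text \<open>Parametrisation of SU(2) by the unit sphere of C^2, and an integral
  proportional to the (bi-invariant) Haar integral: the rotation invariant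
  measure on S^3 obtained from Lebesgue measure on C^2 with Gaussian radial
  weight.\<close>

definition su2_of :: "complex \<times> complex \<Rightarrow> cmat" where
  "su2_of z = (\<chi> i j. if i = 1 \<and> j = 1 then fst z
                     else if i = 1 \<and> j = 2 then - cnj (snd z)
                     else if i = 2 \<and> j = 1 then snd z
                     else cnj (fst z))"

definition haar_int :: "(cmat \<Rightarrow> complex) \<Rightarrow> complex" where
  "haar_int g = (LINT z|lborel. g (su2_of ((1 / norm z) *\<^sub>R z)) * complex_of_real (exp (- (norm z)\<^sup>2)))"

definition smooth_dist :: "((cmat \<Rightarrow> complex) \<Rightarrow> complex) \<Rightarrow> bool" where
  "smooth_dist u = (\<exists>f. smooth_su2 f \<and>
       (\<forall>\<phi>. smooth_su2 \<phi> \<longrightarrow> u \<phi> = haar_int (\<lambda>x. f x * \<phi> x)))"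

definition dpartial0 :: "((cmat \<Rightarrow> complex) \<Rightarrow> complex) \<Rightarrow> ((cmat \<Rightarrow> complex) \<Rightarrow> complex)" where
  "dpartial0 u \<phi> = - u (partial0 \<phi>)"

definition dconj :: "((cmat \<Rightarrow> complex) \<Rightarrow> complex) \<Rightarrow> ((cmat \<Rightarrow> complex) \<Rightarrow> complex)" where
  "dconj u \<phi> = cnj (u (\<lambda>x. cnj (\<phi> x)))"

definition Pop :: "complex \<Rightarrow> complex \<Rightarrow> ((cmat \<Rightarrow> complex) \<Rightarrow> complex) \<Rightarrow> ((cmat \<Rightarrow> complex) \<Rightarrow> complex)" where
  "Pop p q u \<phi> = dpartial0 u \<phi> - q * u \<phi> - p * dconj u \<phi>"

definition globally_hypoelliptic ::
  "(((cmat \<Rightarrow> complex) \<Rightarrow> complex) \<Rightarrow> ((cmat \<Rightarrow> complex) \<Rightarrow> complex)) \<Rightarrow> bool" where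
  "globally_hypoelliptic P = (\<forall>u. is_dist u \<longrightarrow> smooth_dist (P u) \<longrightarrow> smooth_dist u)"

end

theory Submission
  imports Defs "HOL-Probability.Distributions"
begin

text \<open>
  Applying \<open>\<partial>\<^sub>0 - cnj q\<close> to \<open>P u\<close> and adding \<open>p\<close> times the conjugate of \<open>P u\<close> eliminates the
  conjugate of \<open>u\<close>: the result is \<open>(\<partial>\<^sub>0 - z\<^sub>1)(\<partial>\<^sub>0 - z\<^sub>2) u\<close>, where \<open>\<Delta>\<close> at \<open>m\<close> equals
  \<open>(im - z\<^sub>1)(im - z\<^sub>2)\<close>. The orbits \<open>t \<mapsto> x exp(t Z\<^sub>3)\<close> are circles of period \<open>4\<pi>\<close>. If \<open>\<Delta>\<close> has no
  zero at a half-integer, then \<open>exp(4 \<pi> z\<^sub>j) \<noteq> 1\<close> and \<open>\<partial>\<^sub>0 \<plusminus> z\<^sub>j\<close> is inverted on smooth functions by an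
  integral over a period. By duality \<open>\<partial>\<^sub>0 - z\<^sub>j\<close> is injective on distributions, so \<open>u\<close> agrees with
  the smooth solution.

  Conversely, if \<open>\<Delta>\<close> vanishes at \<open>m\<close>, then some combination \<open>w\<close> of a function of weight \<open>m\<close> and
  its conjugate is a smooth solution of \<open>P w = 0\<close>. The measure on the maximal torus with density
  \<open>w\<close> is annihilated by \<open>P\<close> as well, since integration over the torus also kills every \<open>\<partial>\<^sub>0 f\<close>,
  but it is not smooth.
\<close>

section \<open>Functions of class \<open>C\<^sup>k\<close>\<close>

lemma Ck_SucI:
  assumes "\<And>x. (f has_derivative f' x) (at x)" "\<And>v. Ck k (\<lambda>x. f' x v)"
  shows "Ck (Suc k) f"
proof -
  have "frechet_derivative f (at x) = f' x" for x
    using assms(1)[of x] frechet_derivative_at by metis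
  then show ?thesis
    using assms by (auto simp: differentiable_def)
qed

lemma Ck_SucE:
  fixes f :: "'a::real_normed_vector \<Rightarrow> 'b::real_normed_vector"
  assumes "Ck (Suc k) f"
  obtains f' :: "'a \<Rightarrow> 'a \<Rightarrow>\<^sub>L 'b"
  where "\<And>x. (f has_derivative f' x) (at x)" "\<And>v. Ck k (\<lambda>x. f' x v)"
proof
  have deriv: "(f has_derivative frechet_derivative f (at x)) (at x)" for x
    using assms by (simp flip: frechet_derivative_works)
  then have apply_eq: "blinfun_apply (Blinfun (frechet_derivative f (at x))) =
      frechet_derivative f (at x)" for x
    by (intro bounded_linear_Blinfun_apply has_derivative_bounded_linear)
  show "(f has_derivative Blinfun (frechet_derivative f (at x))) (at x)" for x
    using deriv by (simp add: apply_eq)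
  show "Ck k (\<lambda>x. blinfun_apply (Blinfun (frechet_derivative f (at x))) v)" for v
    using assms by (simp add: apply_eq)
qed

lemma Ck_imp_continuous_on:
  assumes "Ck k f"
  shows "continuous_on S f"
proof (cases k)
  case 0
  then show ?thesis using assms by (auto intro: continuous_on_subset)
next
  case (Suc n)
  then show ?thesis
    using assms by (simp add: continuous_at_imp_continuous_on differentiable_imp_continuous_within)
qed

lemma Ck_SucD: "Ck (Suc k) f \<Longrightarrow> Ck k f"
proof (induction k arbitrary: f)
  case 0
  from Ck_imp_continuous_on[OF this] show ?case by simp
next
  case (Suc k)
  then show ?case by (metis Ck.simps(2))
qed

lemma Ck_const: "Ck k (\<lambda>x. c)"
  by (induction k arbitrary: c) (auto intro!: Ck_SucI[where f'="\<lambda>x v. 0"])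

lemma Ck_bounded_linear: "bounded_linear f \<Longrightarrow> Ck k f"
  by (cases k)
     (auto simp del: Ck.simps(2) intro!: Ck_SucI[where f'="\<lambda>x. f"] Ck_const
       intro: bounded_linear_imp_has_derivative linear_continuous_on)

lemma Ck_add:
  assumes "Ck k f" "Ck k g"
  shows "Ck k (\<lambda>x. f x + g x)"
  using assms
proof (induction k arbitrary: f g)
  case 0
  then show ?case by (auto intro: continuous_intros)
next
  case (Suc k)
  obtain f' g' where f': "\<And>x. (f has_derivative blinfun_apply (f' x)) (at x)"
      "\<And>v. Ck k (\<lambda>x. f' x v)"
    and g': "\<And>x. (g has_derivative blinfun_apply (g' x)) (at x)"
      "\<And>v. Ck k (\<lambda>x. g' x v)"
    using Suc.prems by (metis Ck_SucE)
  show ?case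
    by (rule Ck_SucI[where f'="\<lambda>x v. f' x v + g' x v"])
       (auto intro!: f' g' Suc.IH derivative_eq_intros)
qed

lemma Ck_bounded_bilinear:
  assumes "bounded_bilinear B" "Ck k f" "Ck k g"
  shows "Ck k (\<lambda>x. B (f x) (g x))"
  using assms(2,3)
proof (induction k arbitrary: f g)
  case 0
  then show ?case by (auto intro: bounded_bilinear.continuous_on[OF assms(1)])
next
  case (Suc k)
  obtain f' g' where f': "\<And>x. (f has_derivative blinfun_apply (f' x)) (at x)"
      "\<And>v. Ck k (\<lambda>x. f' x v)"
    and g': "\<And>x. (g has_derivative blinfun_apply (g' x)) (at x)"
      "\<And>v. Ck k (\<lambda>x. g' x v)"
    using Suc.prems by (metis Ck_SucE)
  show ?case
    by (rule Ck_SucI[where f'="\<lambda>x v. B (f x) (g' x v) + B (f' x v) (g x)"])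
       (auto intro!: f' g' Suc.IH Ck_add Suc.prems[THEN Ck_SucD]
          bounded_bilinear.FDERIV[OF assms(1)] simp del: Ck.simps)
qed

lemma Ck_bounded_linear_compose:
  assumes "bounded_linear L" "Ck k f"
  shows "Ck k (\<lambda>x. L (f x))"
  using assms(2)
proof (induction k arbitrary: f)
  case 0
  then show ?case by (auto intro: bounded_linear.continuous_on[OF assms(1)])
next
  case (Suc k)
  obtain f' where f': "\<And>x. (f has_derivative blinfun_apply (f' x)) (at x)" "\<And>v. Ck k (\<lambda>x. f' x v)"
    using Suc.prems by (metis Ck_SucE)
  show ?case
    by (rule Ck_SucI[where f'="\<lambda>x v. L (f' x v)"])
       (auto intro!: f' Suc.IH bounded_linear.has_derivative[OF assms(1)])
qed

lemma Ck_sum: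
  assumes "\<And>i. i \<in> I \<Longrightarrow> Ck k (f i)"
  shows "Ck k (\<lambda>x. \<Sum>i\<in>I. f i x)"
  using assms by (induction I rule: infinite_finite_induct) (auto intro: Ck_const Ck_add)

lemma blinfun_apply_euclidean_sum:
  fixes F :: "'a::euclidean_space \<Rightarrow>\<^sub>L 'b::real_normed_vector"
  shows "F v = (\<Sum>b\<in>Basis. (v \<bullet> b) *\<^sub>R F b)"
  by (subst euclidean_representation[of v, symmetric])
     (simp add: blinfun.sum_right blinfun.scaleR_right)

lemma Ck_frechet_derivative_linear:
  fixes g :: "'a::euclidean_space \<Rightarrow> 'b::real_normed_vector"
  assumes "Ck (Suc k) g" "bounded_linear L"
  shows "Ck k (\<lambda>x. frechet_derivative g (at x) (L x))"
proof -
  obtain g' where g': "\<And>x. (g has_derivative blinfun_apply (g' x)) (at x)" "\<And>v. Ck k (\<lambda>x. g' x v)"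
    using Ck_SucE[OF assms(1)] by metis
  have "Ck k (\<lambda>x. (L x \<bullet> b) *\<^sub>R g' x b)" for b
    by (intro Ck_bounded_bilinear[OF bounded_bilinear_scaleR] g'(2) Ck_bounded_linear
        bounded_linear_compose[OF bounded_linear_inner_left assms(2)])
  then have "Ck k (\<lambda>x. g' x (L x))"
    by (subst blinfun_apply_euclidean_sum) (rule Ck_sum)
  moreover have "frechet_derivative g (at x) = g' x" for x
    using frechet_derivative_at[OF g'(1)] by metis
  ultimately show ?thesis by simp
qed

lemma continuous_on_Times_compose_snd:
  assumes "continuous_on T h"
  shows "continuous_on (S \<times> T) (\<lambda>z. h (snd z))"
  by (rule continuous_on_compose2[OF assms]) (auto intro: continuous_intros)

lemma continuous_on_Times_compose_blinfun_apply:
  assumes "continuous_on T A" "continuous_on UNIV g"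
  shows "continuous_on (S \<times> T) (\<lambda>z. g (blinfun_apply (A (snd z)) (fst z)))"
  by (rule continuous_on_compose2[OF assms(2)])
     (auto intro!: blinfun.continuous_on continuous_on_Times_compose_snd assms(1) continuous_intros)

lemma has_derivative_integral_compose_blinfun:
  fixes g :: "'b::real_normed_vector \<Rightarrow> 'c::{banach, real_normed_algebra}"
    and A :: "real \<Rightarrow> 'a::banach \<Rightarrow>\<^sub>L 'b"
  assumes A: "continuous_on {a..b} A" and c: "continuous_on {a..b} c"
    and g: "\<And>y. (g has_derivative blinfun_apply (g' y)) (at y)" and g': "continuous_on UNIV g'"
  shows "((\<lambda>x. integral {a..b} (\<lambda>t. c t * g (A t x))) has_derivative
      (\<lambda>v. integral {a..b} (\<lambda>t. c t * g' (A t x) (A t v)))) (at x)"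
proof -
  define D where "D x t = blinfun_mult_right (c t) o\<^sub>L g' (A t x) o\<^sub>L A t" for x t
  have cont_g: "continuous_on UNIV g"
    using g by (blast intro: has_derivative_continuous continuous_at_imp_continuous_on)
  have cont_D: "continuous_on (UNIV \<times> {a..b}) (\<lambda>(x, t). D x t)"
    unfolding D_def case_prod_beta
    by (intro bounded_bilinear.continuous_on[OF bounded_bilinear_blinfun_compose]
        bounded_linear.continuous_on[OF bounded_linear_blinfun_mult_right]
        continuous_on_Times_compose_snd A c continuous_on_Times_compose_blinfun_apply g')
  have integrable_g: "(\<lambda>t. c t * g (A t x)) integrable_on cbox a b" for x
    unfolding cbox_interval
    by (intro integrable_continuous_real continuous_on_mult c
        continuous_on_compose2[OF cont_g] blinfun.continuous_on A continuous_on_const) auto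
  have "((\<lambda>x. integral (cbox a b) (\<lambda>t. c t * g (A t x))) has_derivative
      blinfun_apply (integral (cbox a b) (D x))) (at x within UNIV)"
  proof (rule leibniz_rule)
    have A_deriv: "((\<lambda>x. A t x) has_derivative blinfun_apply (A t)) (at x)" for t x
      by (rule bounded_linear_imp_has_derivative) (rule blinfun.bounded_linear_right)
    show "((\<lambda>x. c t * g (A t x)) has_derivative blinfun_apply (D x t)) (at x within UNIV)" for x t
      unfolding D_def
      using has_derivative_mult_right[OF has_derivative_compose[OF A_deriv g[of "A t x"]], of "c t"]
      by (simp add: blinfun_compose.rep_eq o_def)
  qed (use cont_D integrable_g in auto)
  moreover have "blinfun_apply (integral {a..b} (D x)) =
      (\<lambda>v. integral {a..b} (\<lambda>t. c t * g' (A t x) (A t v)))"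
  proof
    fix v
    have "continuous_on {a..b} (\<lambda>t. D x t)"
      by (rule continuous_on_compose2[OF cont_D, of _ "\<lambda>t. (x, t)", simplified])
         (auto intro: continuous_intros)
    then show "blinfun_apply (integral {a..b} (D x)) v =
        integral {a..b} (\<lambda>t. c t * g' (A t x) (A t v))"
      by (simp add: blinfun_apply_integral integrable_continuous_real D_def)
  qed
  ultimately show ?thesis by simp
qed

lemma Ck_integral_compose_blinfun:
  fixes g :: "'b::euclidean_space \<Rightarrow> 'c::{banach, real_normed_algebra}"
    and A :: "real \<Rightarrow> 'a::banach \<Rightarrow>\<^sub>L 'b"
  assumes A: "continuous_on {a..b} A" and "continuous_on {a..b} c" "Ck k g"
  shows "Ck k (\<lambda>x. integral {a..b} (\<lambda>t. c t * g (A t x)))"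
  using assms(2,3)
proof (induction k arbitrary: c g)
  case 0
  have "continuous_on (UNIV \<times> {a..b}) (\<lambda>z. c (snd z) * g (A (snd z) (fst z)))"
    using 0 by (intro continuous_on_mult continuous_on_Times_compose_blinfun_apply A
        continuous_on_Times_compose_snd) auto
  then have "continuous_on UNIV (\<lambda>x. integral (cbox a b) (\<lambda>t. c t * g (A t x)))"
    by (intro integral_continuous_on_param) (simp add: case_prod_beta)
  then show ?case by simp
next
  case (Suc k)
  obtain g' where g': "\<And>y. (g has_derivative blinfun_apply (g' y)) (at y)" "\<And>v. Ck k (\<lambda>y. g' y v)"
    using Ck_SucE[OF Suc.prems(2)] by metis
  have cont_g': "continuous_on UNIV g'"
    by (intro continuous_on_blinfun_componentwise Ck_imp_continuous_on[OF g'(2)])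
  show ?case
  proof (rule Ck_SucI)
    show "((\<lambda>x. integral {a..b} (\<lambda>t. c t * g (A t x))) has_derivative
        (\<lambda>v. integral {a..b} (\<lambda>t. c t * g' (A t x) (A t v)))) (at x)" for x
      by (rule has_derivative_integral_compose_blinfun[OF A Suc.prems(1) g'(1) cont_g'])
    fix v
    let ?c = "\<lambda>d t. (A t v \<bullet> d) *\<^sub>R c t"
    have cont_c: "continuous_on {a..b} (?c d)" for d
      by (intro continuous_intros blinfun.continuous_on A Suc.prems(1))
    have "c t * g' (A t x) (A t v) = (\<Sum>d\<in>Basis. ?c d t * g' (A t x) d)" for x t
      by (subst blinfun_apply_euclidean_sum) (simp add: sum_distrib_left)
    moreover have "(\<lambda>t. ?c d t * g' (A t x) d) integrable_on {a..b}" for x d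
      by (intro integrable_continuous_real continuous_on_mult cont_c blinfun.continuous_on
          continuous_on_compose2[OF cont_g'] A continuous_on_const) auto
    ultimately have "integral {a..b} (\<lambda>t. c t * g' (A t x) (A t v)) =
        (\<Sum>d\<in>Basis. integral {a..b} (\<lambda>t. ?c d t * g' (A t x) d))" for x
      by (simp only: integral_sum[OF finite_Basis])
    then show "Ck k (\<lambda>x. integral {a..b} (\<lambda>t. c t * g' (A t x) (A t v)))"
      by (simp only:) (intro Ck_sum Suc.IH cont_c g'(2))
  qed
qed

section \<open>Invariance of Lebesgue measure\<close>

lemma emeasure_lborel_open_le_if_ball_le:
  fixes M :: "'a::euclidean_space measure"
  assumes sets_M: "sets M = sets borel" and "open U"
    and ball_le: "\<And>x r. emeasure lborel (ball x r) \<le> emeasure M (ball x r)"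
  shows "emeasure lborel U \<le> emeasure M U"
proof -
  define K where "K = {(x, r). ball x r \<subseteq> U}"
  have "\<exists>i. i \<in> K \<and> x \<in> ball (fst i) (snd i) \<and> snd i < d" if "x \<in> U" "0 < d" for x d
  proof -
    obtain r where "0 < r" "ball x r \<subseteq> U"
      using \<open>open U\<close> \<open>x \<in> U\<close> by (rule openE)
    then show ?thesis
      using \<open>0 < d\<close> by (intro exI[of _ "(x, min r (d/2))"]) (auto simp: K_def)
  qed
  then obtain C where C: "countable C" "C \<subseteq> K"
      "pairwise (\<lambda>i j. disjnt (ball (fst i) (snd i)) (ball (fst j) (snd j))) C"
      "negligible (U - (\<Union>i\<in>C. ball (fst i) (snd i)))"
    by (rule Vitali_covering_theorem_balls)
  define B where "B = (\<Union>i\<in>C. ball (fst i) (snd i))"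
  have disj: "disjoint_family_on (\<lambda>i. ball (fst i) (snd i)) C"
    using C(3) unfolding disjoint_family_on_def pairwise_def disjnt_def by blast
  have "open B" "B \<subseteq> U"
    using C(2) by (fastforce simp: B_def K_def)+
  then have "U - B \<in> null_sets lborel"
    using C(4) \<open>open U\<close>
    by (simp add: B_def negligible_iff_null_sets null_sets_completion_iff)
  then have "emeasure lborel U = emeasure lborel B"
    using emeasure_Un_null_set[of B lborel "U - B"] \<open>open B\<close> \<open>B \<subseteq> U\<close> by (simp add: Un_absorb1)
  also have "\<dots> = (\<integral>\<^sup>+i. emeasure lborel (ball (fst i) (snd i)) \<partial>count_space C)"
    unfolding B_def using C(1) disj by (intro emeasure_UN_countable) auto
  also have "\<dots> \<le> (\<integral>\<^sup>+i. emeasure M (ball (fst i) (snd i)) \<partial>count_space C)"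
    by (intro nn_integral_mono ball_le)
  also have "\<dots> = emeasure M B"
    unfolding B_def using C(1) disj
    by (intro emeasure_UN_countable[symmetric]) (auto simp: sets_M)
  also have "\<dots> \<le> emeasure M U"
    using \<open>B \<subseteq> U\<close> \<open>open U\<close> by (intro emeasure_mono) (auto simp: sets_M)
  finally show ?thesis .
qed

lemma continuous_on_orthogonal_transformation:
  fixes f :: "'a::euclidean_space \<Rightarrow> 'a"
  assumes "orthogonal_transformation f"
  shows "continuous_on S f"
  using assms by (intro linear_continuous_on linear_conv_bounded_linear[THEN iffD1]
      orthogonal_transformation_linear)

lemma emeasure_lborel_open_le_vimage_orthogonal:
  fixes f :: "'a::euclidean_space \<Rightarrow> 'a"
  assumes f: "orthogonal_transformation f" and "open U"
  shows "emeasure lborel U \<le> emeasure lborel (f -` U)"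
proof -
  have f_borel: "f \<in> borel \<rightarrow>\<^sub>M borel"
    by (intro borel_measurable_continuous_onI continuous_on_orthogonal_transformation f)
  have vimage: "emeasure (distr lborel borel f) A = emeasure lborel (f -` A)" if "open A" for A
    using f_borel that by (subst emeasure_distr) auto
  have "emeasure (distr lborel borel f) (ball x r) = emeasure lborel (ball x r)" for x r
  proof -
    have "f (inv f x) = x"
      using orthogonal_transformation_surj[OF f] by (rule surj_f_inv_f)
    then have "f -` ball x r = ball (inv f x) r"
      using image_orthogonal_transformation_ball[OF f, of "inv f x" r]
        inj_vimage_image_eq[OF orthogonal_transformation_inj[OF f], of "ball (inv f x) r"] by simp
    then show ?thesis
      by (cases "0 \<le> r") (simp_all add: vimage emeasure_ball ball_empty)
  qed
  then have "emeasure lborel U \<le> emeasure (distr lborel borel f) U"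
    using \<open>open U\<close> by (simp add: emeasure_lborel_open_le_if_ball_le)
  then show ?thesis by (simp add: vimage \<open>open U\<close>)
qed

theorem lborel_distr_orthogonal_transformation:
  fixes f :: "'a::euclidean_space \<Rightarrow> 'a"
  assumes f: "orthogonal_transformation f"
  shows "distr lborel borel f = lborel"
proof (rule lborel_eqI[symmetric])
  fix l u :: 'a
  assume "\<And>b. b \<in> Basis \<Longrightarrow> l \<bullet> b \<le> u \<bullet> b"
  have cont: "continuous_on UNIV f"
    by (rule continuous_on_orthogonal_transformation[OF f])
  have "emeasure lborel (f -` box l u) \<le> emeasure lborel (inv f -` (f -` box l u))"
    using f open_vimage[OF open_box cont]
    by (intro emeasure_lborel_open_le_vimage_orthogonal orthogonal_transformation_inv)
  also have "inv f -` (f -` box l u) = box l u"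
    using orthogonal_transformation_surj[OF f] by (auto simp: surj_f_inv_f)
  finally have "emeasure lborel (f -` box l u) = emeasure lborel (box l u)"
    using emeasure_lborel_open_le_vimage_orthogonal[OF f open_box] by (rule antisym)
  with \<open>\<And>b. b \<in> Basis \<Longrightarrow> l \<bullet> b \<le> u \<bullet> b\<close>
  show "emeasure (distr lborel borel f) (box l u) = (\<Prod>b\<in>Basis. (u - l) \<bullet> b)"
    using cont by (subst emeasure_distr) (auto intro: borel_measurable_continuous_onI)
qed simp

lemma integrable_exp_minus_norm_power2:
  "integrable lborel (\<lambda>z::'a::euclidean_space. exp (- (norm z)\<^sup>2))"
proof (rule integrableI_bounded)
  have gaussian: "integrable lborel (\<lambda>x::real. exp (- x\<^sup>2))"
    using has_bochner_integral_even_function[OF gaussian_moment_0]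
    by (auto simp: has_bochner_integral_iff)
  have "(norm z)\<^sup>2 = (\<Sum>b\<in>Basis. (z \<bullet> b)\<^sup>2)" for z :: 'a
    unfolding power2_norm_eq_inner by (subst euclidean_inner) (simp add: power2_eq_square)
  then have "exp (- (norm z)\<^sup>2) = (\<Prod>b\<in>Basis. exp (- (z \<bullet> b)\<^sup>2))" for z :: 'a
    by (simp add: exp_sum sum_negf[symmetric])
  then have "(\<integral>\<^sup>+z. norm (exp (- (norm z)\<^sup>2)) \<partial>(lborel :: 'a measure)) =
      (\<integral>\<^sup>+z. (\<Prod>b\<in>Basis. ennreal (exp (- (z \<bullet> b)\<^sup>2))) \<partial>(lborel :: 'a measure))"
    by (simp add: prod_ennreal abs_prod)
  also have "\<dots> = (\<Prod>b\<in>(Basis::'a set). (\<integral>\<^sup>+x. exp (- x\<^sup>2) \<partial>lborel))"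
    by (subst nn_integral_lborel_prod) auto
  also have "\<dots> < \<infinity>"
    using gaussian
    by (subst nn_integral_eq_integral) (auto simp: ennreal_power[symmetric] power_less_top_ennreal)
  finally show "(\<integral>\<^sup>+z. norm (exp (- (norm z)\<^sup>2)) \<partial>(lborel :: 'a measure)) < \<infinity>" .
qed simp

section \<open>The group SU(2)\<close>

lemma cmat_eq_iff:
  "(A::cmat) = B \<longleftrightarrow> A$1$1 = B$1$1 \<and> A$1$2 = B$1$2 \<and> A$2$1 = B$2$1 \<and> A$2$2 = B$2$2"
  by (auto simp: vec_eq_iff forall_2)

lemma SU2_eq_image_sphere: "SU2 = su2_of ` sphere 0 1"
proof
  show "su2_of ` sphere 0 1 \<subseteq> SU2"
  proof
    fix U assume "U \<in> su2_of ` sphere 0 1"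
    then obtain z where U: "U = su2_of z" and "norm z = 1" by auto
    then have "(cmod (fst z))\<^sup>2 + (cmod (snd z))\<^sup>2 = 1"
      by (simp add: norm_prod_def)
    then have "fst z * cnj (fst z) + snd z * cnj (snd z) = 1"
      by (simp flip: complex_norm_square of_real_add of_real_power)
    then show "U \<in> SU2"
      by (simp add: U SU2_def su2_of_def cmat_eq_iff adj_def matrix_matrix_mult_def sum_2 det_2
          mat_def algebra_simps)
  qed
  show "SU2 \<subseteq> su2_of ` sphere 0 1"
  proof
    fix U assume "U \<in> SU2"
    define a b c d where "a = U$1$1" "b = U$1$2" "c = U$2$1" "d = U$2$2"
    have unitary: "a * cnj a + c * cnj c = 1" "cnj a * b + cnj c * d = 0"
      and det: "a * d - b * c = 1"
      using \<open>U \<in> SU2\<close> unfolding SU2_def a_b_c_d_def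
      by (auto simp: cmat_eq_iff adj_def matrix_matrix_mult_def sum_2 det_2 mat_def mult.commute)
    have "d = cnj a" "b = - cnj c"
      using unitary det by algebra+
    then have "U = su2_of (a, c)"
      by (simp add: cmat_eq_iff su2_of_def a_b_c_d_def)
    moreover have "complex_of_real ((cmod a)\<^sup>2 + (cmod c)\<^sup>2) = 1"
      using unitary(1) unfolding of_real_add complex_norm_square .
    then have "norm (a, c) = 1"
      by (simp add: norm_prod_def del: of_real_add of_real_power)
    ultimately show "U \<in> su2_of ` sphere 0 1" by auto
  qed
qed

lemma su2_of_in_SU2: "norm z = 1 \<Longrightarrow> su2_of z \<in> SU2"
  by (auto simp: SU2_eq_image_sphere)

lemma SU2_E:
  assumes "x \<in> SU2"
  obtains z where "norm z = 1" "x = su2_of z"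
  using assms by (auto simp: SU2_eq_image_sphere)

definition su2_rotation :: "complex \<times> complex \<Rightarrow> complex \<times> complex \<Rightarrow> complex \<times> complex" where
  "su2_rotation w z = (fst w * fst z - snd w * cnj (snd z), fst w * snd z + snd w * cnj (fst z))"

lemma su2_of_mult: "su2_of z ** su2_of w = su2_of (su2_rotation w z)"
  by (simp add: su2_of_def su2_rotation_def cmat_eq_iff matrix_matrix_mult_def sum_2 algebra_simps)

lemma norm_su2_rotation: "norm (su2_rotation w z) = norm w * norm z"
proof -
  have "(norm (su2_rotation w z))\<^sup>2 = (norm w * norm z)\<^sup>2"
    by (simp add: norm_prod_def su2_rotation_def cmod_power2 power_mult_distrib)
       (simp add: power2_eq_square algebra_simps)
  then show ?thesis by simp
qed

lemma orthogonal_transformation_su2_rotation: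
  assumes "norm w = 1"
  shows "orthogonal_transformation (su2_rotation w)"
proof -
  have "linear (su2_rotation w)"
    by (rule linearI) (simp_all add: su2_rotation_def prod_eq_iff scaleR_conv_of_real algebra_simps)
  then show ?thesis
    by (simp add: orthogonal_transformation norm_su2_rotation assms)
qed

lemma SU2_mult: "x \<in> SU2 \<Longrightarrow> y \<in> SU2 \<Longrightarrow> x ** y \<in> SU2"
  by (elim SU2_E) (simp add: su2_of_mult su2_of_in_SU2 norm_su2_rotation)

lemma mat1_in_SU2: "mat 1 \<in> SU2"
  by (simp add: SU2_def adj_def cmat_eq_iff matrix_matrix_mult_def sum_2 mat_def det_2)

lemma continuous_on_su2_of: "continuous_on S su2_of"
proof -
  have "continuous_on S (\<lambda>z. su2_of z $ i $ j)" for i j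
    using exhaust_2[of i] exhaust_2[of j] by (auto simp: su2_of_def intro!: continuous_intros)
  then have "continuous_on S (\<lambda>z. \<chi> i j. su2_of z $ i $ j)"
    by (intro continuous_on_vec_lambda)
  then show ?thesis by simp
qed

lemma compact_SU2: "compact SU2"
  unfolding SU2_eq_image_sphere
  by (intro compact_continuous_image continuous_on_su2_of compact_sphere)

lemma continuous_on_SU2_bounded:
  fixes f :: "cmat \<Rightarrow> 'a::real_normed_vector"
  assumes "continuous_on SU2 f"
  obtains B where "B \<ge> 0" "\<And>x. x \<in> SU2 \<Longrightarrow> norm (f x) \<le> B"
proof -
  have "bounded (f ` SU2)"
    using compact_continuous_image[OF assms compact_SU2] by (rule compact_imp_bounded)
  then obtain B where "B > 0" "\<And>x. x \<in> SU2 \<Longrightarrow> norm (f x) \<le> B"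
    unfolding bounded_pos by auto
  then show thesis using that[of B] by simp
qed

lemma cmod_SU2_diagonal_product:
  assumes "x \<in> SU2"
  shows "cmod (x$1$1 * x$2$2) = 1 - (cmod (x$2$1))\<^sup>2"
proof -
  obtain z where "norm z = 1" and x: "x = su2_of z"
    using assms by (rule SU2_E)
  then have "(cmod (fst z))\<^sup>2 = 1 - (cmod (snd z))\<^sup>2"
    by (simp add: norm_prod_def)
  then show ?thesis
    by (simp add: x su2_of_def norm_mult flip: power2_eq_square)
qed

lemma expZ_eq: "expZ j t = cos (t/2) *\<^sub>R mat 1 + (2 * sin (t/2)) *\<^sub>R Zb j"
  unfolding vec_eq_iff vector_add_component vector_scaleR_component
  by (simp add: expZ_def scaleR_conv_of_real)

lemma expZ_in_SU2: "expZ j t \<in> SU2"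
proof -
  define c s where "c = cos (t/2)" "s = sin (t/2)"
  have cs: "c\<^sup>2 + s\<^sup>2 = 1"
    by (simp add: c_s_def)
  define z where "z = (if j = 1 then (complex_of_real c, \<i> * complex_of_real s)
    else if j = 2 then (complex_of_real c, - complex_of_real s) else (Complex c s, 0))"
  have "expZ j t = su2_of z"
    by (simp add: z_def expZ_def Zb_def su2_of_def mat_def cmat_eq_iff complex_eq_iff flip: c_s_def)
  moreover have "norm z = 1"
    using cs by (simp add: z_def norm_prod_def norm_mult cmod_def)
  ultimately show ?thesis by (simp add: su2_of_in_SU2)
qed

lemma SU2_mult_expZ: "x \<in> SU2 \<Longrightarrow> x ** expZ j t \<in> SU2"
  by (intro SU2_mult expZ_in_SU2)

lemma bounded_linear_cmat_mult_right: "bounded_linear (\<lambda>x::cmat. x ** (B::cmat))"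
  by (rule linear_conv_bounded_linear[THEN iffD1], rule linearI)
     (unfold cmat_eq_iff vector_add_component vector_scaleR_component,
      simp_all add: matrix_matrix_mult_def sum_2 algebra_simps)

lemma mult_expZ: "(x::cmat) ** expZ j t = cos (t/2) *\<^sub>R x + (2 * sin (t/2)) *\<^sub>R (x ** Zb j)"
  unfolding cmat_eq_iff vector_add_component vector_scaleR_component
  by (simp add: expZ_def matrix_matrix_mult_def sum_2 mat_def scaleR_conv_of_real algebra_simps)

lemma Zb_mult_Zb: "Zb j ** Zb j = (- 1/4) *\<^sub>R mat 1"
  unfolding cmat_eq_iff vector_scaleR_component
  by (simp add: Zb_def matrix_matrix_mult_def sum_2 mat_def scaleR_conv_of_real)

lemma mult_expZ_mult_Zb:
  "(x::cmat) ** expZ j t ** Zb j = (- sin (t/2) / 2) *\<^sub>R x + cos (t/2) *\<^sub>R (x ** Zb j)"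
proof -
  interpret right_mult_Zb: bounded_linear "\<lambda>x::cmat. x ** Zb j"
    by (rule bounded_linear_cmat_mult_right)
  have "x ** Zb j ** Zb j = (- 1/4) *\<^sub>R x"
    unfolding matrix_mul_assoc[symmetric] Zb_mult_Zb
    unfolding cmat_eq_iff vector_scaleR_component
    by (simp add: matrix_matrix_mult_def sum_2 mat_def)
  then show ?thesis
    by (simp add: mult_expZ[of x] right_mult_Zb.add right_mult_Zb.scaleR)
qed

lemma expZ_add: "expZ j s ** expZ j t = expZ j (s + t)"
proof -
  have "expZ j s ** expZ j t =
      cos (t/2) *\<^sub>R expZ j s + (2 * sin (t/2)) *\<^sub>R (mat 1 ** expZ j s ** Zb j)"
    by (simp only: mult_expZ[of "expZ j s"] matrix_mul_lid)
  also have "\<dots> = cos (s/2 + t/2) *\<^sub>R mat 1 + (2 * sin (s/2 + t/2)) *\<^sub>R Zb j"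
    unfolding mult_expZ_mult_Zb unfolding expZ_eq[of j s] cos_add sin_add
    by (simp add: algebra_simps)
  also have "\<dots> = expZ j (s + t)"
    by (simp add: expZ_eq add_divide_distrib)
  finally show ?thesis .
qed

lemma mult_expZ_add: "(x::cmat) ** expZ j s ** expZ j t = x ** expZ j (s + t)"
  by (simp add: expZ_add flip: matrix_mul_assoc)

lemma expZ_0: "expZ j 0 = mat 1"
  by (simp add: expZ_eq)

lemma expZ_4pi: "expZ j (4 * pi) = mat 1"
  by (simp add: expZ_eq)

lemma expZ_3_entries:
  "expZ 3 t = (\<chi> a b. if a = b then (if a = 1 then cis (t/2) else cis (- (t/2))) else 0)"
  by (simp add: cmat_eq_iff expZ_def Zb_def mat_def complex_eq_iff)

lemma has_vector_derivative_mult_expZ: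
  "((\<lambda>t. (x::cmat) ** expZ j t) has_vector_derivative (x ** expZ j s) ** Zb j) (at s)"
  unfolding mult_expZ_mult_Zb unfolding mult_expZ by (auto intro!: derivative_eq_intros)

lemma continuous_on_mult_expZ: "continuous_on S (\<lambda>t. (x::cmat) ** expZ j t)"
  using has_vector_derivative_mult_expZ
  by (auto intro!: continuous_at_imp_continuous_on has_vector_derivative_continuous)

section \<open>Smooth functions on SU(2)\<close>

lemma smooth_su2E:
  assumes "smooth_su2 f"
  obtains g where "\<And>k. Ck k g" "\<And>x. x \<in> SU2 \<Longrightarrow> f x = g x"
  using assms unfolding smooth_su2_def smooth_amb_def by metis

lemma smooth_su2I:
  assumes "\<And>k. Ck k g" "\<And>x. x \<in> SU2 \<Longrightarrow> f x = g x"
  shows "smooth_su2 f"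
  using assms unfolding smooth_su2_def smooth_amb_def by metis

lemma smooth_su2_cong:
  assumes "smooth_su2 f" "\<And>x. x \<in> SU2 \<Longrightarrow> g x = f x"
  shows "smooth_su2 g"
  using assms unfolding smooth_su2_def by metis

lemma smooth_su2_imp_continuous_on: "smooth_su2 f \<Longrightarrow> continuous_on SU2 f"
  by (metis Ck_imp_continuous_on continuous_on_cong smooth_su2E)

lemma smooth_su2_const: "smooth_su2 (\<lambda>x. c)"
  by (rule smooth_su2I[of "\<lambda>x. c"]) (auto intro: Ck_const)

lemma smooth_su2_add:
  assumes "smooth_su2 f" "smooth_su2 g"
  shows "smooth_su2 (\<lambda>x. f x + g x)"
  using assms by (elim smooth_su2E, intro smooth_su2I) (auto intro: Ck_add)

lemma smooth_su2_mult:
  assumes "smooth_su2 f" "smooth_su2 g"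
  shows "smooth_su2 (\<lambda>x. f x * g x)"
  using assms
  by (elim smooth_su2E, intro smooth_su2I)
     (auto intro: Ck_bounded_bilinear[OF bounded_bilinear_mult])

lemma smooth_su2_diff:
  assumes "smooth_su2 f" "smooth_su2 g"
  shows "smooth_su2 (\<lambda>x. f x - g x)"
  using smooth_su2_add[OF assms(1) smooth_su2_mult[OF smooth_su2_const[of "-1"] assms(2)]] by simp

lemma smooth_su2_power: "smooth_su2 f \<Longrightarrow> smooth_su2 (\<lambda>x. f x ^ n)"
  by (induction n) (auto intro: smooth_su2_const smooth_su2_mult)

lemma smooth_su2_entry: "smooth_su2 (\<lambda>x. x $ a $ b)"
  by (rule smooth_su2I[OF Ck_bounded_linear])
     (auto intro: bounded_linear_compose[OF bounded_linear_vec_nth bounded_linear_vec_nth])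

lemma smooth_su2_cnj: "smooth_su2 f \<Longrightarrow> smooth_su2 (\<lambda>x. cnj (f x))"
  by (elim smooth_su2E, intro smooth_su2I)
     (auto intro: Ck_bounded_linear_compose[OF bounded_linear_cnj])

lemma continuous_on_mult_expZ_compose:
  assumes "continuous_on SU2 f" "x \<in> SU2"
  shows "continuous_on S (\<lambda>t. f (x ** expZ j t))"
  by (rule continuous_on_compose2[OF assms(1) continuous_on_mult_expZ])
     (use assms(2) in \<open>auto intro: SU2_mult_expZ\<close>)

lemma has_vector_derivative_extension_mult_expZ:
  assumes "Ck (Suc 0) g" "\<And>x. x \<in> SU2 \<Longrightarrow> f x = g x" "x \<in> SU2"
  shows "((\<lambda>t. f (x ** expZ j t)) has_vector_derivative
      frechet_derivative g (at (x ** expZ j s)) (x ** expZ j s ** Zb j)) (at s)"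
proof -
  have "(g has_derivative frechet_derivative g (at (x ** expZ j s))) (at (x ** expZ j s))"
    using assms(1) by (simp flip: frechet_derivative_works)
  from vector_derivative_diff_chain_within[OF has_vector_derivative_mult_expZ
      has_derivative_at_withinI[OF this]]
  have "((\<lambda>t. g (x ** expZ j t)) has_vector_derivative
      frechet_derivative g (at (x ** expZ j s)) (x ** expZ j s ** Zb j)) (at s)"
    by (simp add: o_def)
  then show ?thesis
    using assms by (simp add: SU2_mult_expZ)
qed

lemma lider_eqI:
  assumes "((\<lambda>t. f (x ** expZ j t)) has_vector_derivative d) (at 0)"
  shows "lider j f x = d"
  using assms by (simp add: lider_def vector_derivative_at)

lemma lider_eq_frechet_derivative:
  assumes "Ck (Suc 0) g" "\<And>x. x \<in> SU2 \<Longrightarrow> f x = g x" "x \<in> SU2"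
  shows "lider j f x = frechet_derivative g (at x) (x ** Zb j)"
  using has_vector_derivative_extension_mult_expZ[OF assms, of j 0]
  by (intro lider_eqI) (simp add: expZ_0)

lemma has_vector_derivative_lider:
  assumes "smooth_su2 f" "x \<in> SU2"
  shows "((\<lambda>t. f (x ** expZ j t)) has_vector_derivative lider j f (x ** expZ j s)) (at s)"
proof -
  obtain g where g: "Ck (Suc 0) g" "\<And>x. x \<in> SU2 \<Longrightarrow> f x = g x"
    using smooth_su2E[OF assms(1)] by metis
  show ?thesis
    using has_vector_derivative_extension_mult_expZ[OF g assms(2), of j s]
    by (simp add: lider_eq_frechet_derivative[OF g SU2_mult_expZ[OF assms(2)]])
qed

lemma has_vector_derivative_lider_at_0:
  assumes "smooth_su2 f" "x \<in> SU2"
  shows "((\<lambda>t. f (x ** expZ j t)) has_vector_derivative lider j f x) (at 0)"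
  using has_vector_derivative_lider[OF assms, of j 0] by (simp add: expZ_0)

lemma smooth_su2_lider:
  assumes "smooth_su2 f"
  shows "smooth_su2 (lider j f)"
proof -
  obtain g where g: "\<And>k. Ck k g" "\<And>x. x \<in> SU2 \<Longrightarrow> f x = g x"
    using smooth_su2E[OF assms] by metis
  then have "Ck k (\<lambda>x. frechet_derivative g (at x) (x ** Zb j))" for k
    by (intro Ck_frechet_derivative_linear bounded_linear_cmat_mult_right)
  then show ?thesis
    using lider_eq_frechet_derivative[OF g] by (rule smooth_su2I)
qed

lemmas smooth_su2_intros = smooth_su2_const smooth_su2_add smooth_su2_mult smooth_su2_diff
  smooth_su2_power smooth_su2_entry smooth_su2_cnj smooth_su2_lider

lemma lider_cong:
  assumes "\<And>y. y \<in> SU2 \<Longrightarrow> f y = g y" "x \<in> SU2"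
  shows "lider j f x = lider j g x"
  unfolding lider_def using assms by (simp add: SU2_mult_expZ)

lemma lider_const: "lider j (\<lambda>x. c) x = 0"
  by (rule lider_eqI) simp

lemma lider_add:
  assumes "smooth_su2 f" "smooth_su2 g" "x \<in> SU2"
  shows "lider j (\<lambda>x. f x + g x) x = lider j f x + lider j g x"
  by (intro lider_eqI has_vector_derivative_add has_vector_derivative_lider_at_0 assms)

lemma lider_mult:
  assumes "smooth_su2 f" "smooth_su2 g" "x \<in> SU2"
  shows "lider j (\<lambda>x. f x * g x) x = f x * lider j g x + lider j f x * g x"
  using has_vector_derivative_mult[OF has_vector_derivative_lider_at_0[OF assms(1,3)]
      has_vector_derivative_lider_at_0[OF assms(2,3)]]
  by (intro lider_eqI) (simp add: expZ_0)

lemma lider_cmult: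
  assumes "smooth_su2 f" "x \<in> SU2"
  shows "lider j (\<lambda>x. c * f x) x = c * lider j f x"
  using lider_mult[OF smooth_su2_const[of c] assms] by (simp add: lider_const)

lemma lider_cnj:
  assumes "smooth_su2 f" "x \<in> SU2"
  shows "lider j (\<lambda>x. cnj (f x)) x = cnj (lider j f x)"
  by (intro lider_eqI has_vector_derivative_cnj has_vector_derivative_lider_at_0 assms)

section \<open>Solving the equation on the orbits of a left-invariant field\<close>

lemma has_vector_derivative_moving_integral:
  fixes k :: "real \<Rightarrow> 'a::banach"
  assumes cont: "continuous_on UNIV k" and "0 \<le> T"
  shows "((\<lambda>s. integral {0..T} (\<lambda>t. k (s + t))) has_vector_derivative k (s + T) - k s) (at s)"
proof -
  define I where "I = {s - 1<..<s + T + 1}"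
  have "continuous_on {s - 1..s + T + 1} k"
    by (rule continuous_on_subset[OF cont]) simp
  then obtain F where F_within: "\<And>t. t \<in> {s - 1..s + T + 1} \<Longrightarrow>
      (F has_vector_derivative k t) (at t within {s - 1..s + T + 1})"
    by (rule antiderivative_continuous) blast
  have F: "((\<lambda>t. F (t + u)) has_vector_derivative k (t + u)) (at t)" if "t + u \<in> I" for t u
  proof -
    have "at (t + u) within {s - 1..s + T + 1} = at (t + u)"
      using that by (intro at_within_Icc_at) (auto simp: I_def)
    then have "(F has_vector_derivative k (t + u)) (at (t + u))"
      using F_within[of "t + u"] that by (simp add: I_def)
    moreover have "((\<lambda>t. t + u) has_vector_derivative 1) (at t)"
      by (auto intro!: derivative_eq_intros)
    ultimately show ?thesis
      using vector_diff_chain_at[of "\<lambda>t. t + u" 1 t F] by (simp add: o_def)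
  qed
  have integral_eq: "F (r + T) - F (r + 0) = integral {0..T} (\<lambda>t. k (r + t))"
    if r: "r \<in> {s - 1<..<s + 1}" for r
  proof -
    have "((\<lambda>t. k (t + r)) has_integral F (T + r) - F (0 + r)) {0..T}"
    proof (rule fundamental_theorem_of_calculus)
      show "((\<lambda>t. F (t + r)) has_vector_derivative k (t + r)) (at t within {0..T})"
        if "t \<in> {0..T}" for t
        by (rule has_vector_derivative_at_within, rule F) (use r that in \<open>auto simp: I_def\<close>)
    qed fact
    then show ?thesis by (simp add: integral_unique add.commute)
  qed
  have "((\<lambda>r. F (r + T) - F (r + 0)) has_vector_derivative k (s + T) - k (s + 0)) (at s)"
    using \<open>0 \<le> T\<close> by (intro has_vector_derivative_diff F) (auto simp: I_def)
  from has_vector_derivative_transform_within_open[OF this _ _ integral_eq, of "{s - 1<..<s + 1}"]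
  show ?thesis by simp
qed

lemma has_vector_derivative_period_integral:
  fixes h :: "real \<Rightarrow> complex" and \<mu> :: complex
  assumes cont: "continuous_on UNIV h" and period: "\<And>t. h (t + T) = h t" and "0 \<le> T"
  defines "y \<equiv> \<lambda>s. integral {0..T} (\<lambda>t. exp (- \<mu> * complex_of_real t) * h (s + t))"
  shows "(y has_vector_derivative \<mu> * y s + (exp (- \<mu> * complex_of_real T) - 1) * h s) (at s)"
proof -
  define E where "E r t = exp (r * complex_of_real t)" for r t
  have E_deriv: "(E r has_vector_derivative r * E r t) (at t)" for r t
    unfolding E_def by (rule has_vector_derivative_real_field) (auto intro!: derivative_eq_intros)
  have E_add: "E r (t + u) = E r t * E r u" and E_neg: "E r t * E (- r) t = 1" for r t u
    by (simp_all add: E_def algebra_simps flip: exp_add)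
  define Y where "Y s = integral {0..T} (\<lambda>t. E (- \<mu>) (s + t) * h (s + t))" for s
  have Y: "(Y has_vector_derivative E (- \<mu>) (s + T) * h (s + T) - E (- \<mu>) s * h s) (at s)"
    unfolding Y_def using \<open>0 \<le> T\<close>
    by (intro has_vector_derivative_moving_integral[of "\<lambda>t. E (- \<mu>) t * h t"])
       (auto simp: E_def intro!: continuous_intros cont)
  have y_eq: "y = (\<lambda>s. E \<mu> s * Y s)"
  proof
    fix s
    have "E \<mu> s * Y s = integral {0..T} (\<lambda>t. (E \<mu> s * E (- \<mu>) s) * (E (- \<mu>) t * h (s + t)))"
      by (simp add: Y_def E_add mult.assoc)
    then show "y s = E \<mu> s * Y s"
      by (simp only: E_neg) (simp add: y_def E_def)
  qed
  have "E \<mu> s * (E (- \<mu>) (s + T) * h (s + T) - E (- \<mu>) s * h s) =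
      (E \<mu> s * E (- \<mu>) s) * ((E (- \<mu>) T - 1) * h s)"
    by (simp only: E_add period) (simp add: algebra_simps)
  also have "\<dots> = (exp (- \<mu> * complex_of_real T) - 1) * h s"
    by (simp only: E_neg) (simp add: E_def)
  finally have "E \<mu> s * (E (- \<mu>) (s + T) * h (s + T) - E (- \<mu>) s * h s) + \<mu> * E \<mu> s * Y s =
      \<mu> * y s + (exp (- \<mu> * complex_of_real T) - 1) * h s"
    by (simp add: y_eq)
  then show ?thesis
    using has_vector_derivative_mult[OF E_deriv[of \<mu>] Y] by (simp only: y_eq)
qed

lemma smooth_su2_integral_mult_expZ:
  assumes "smooth_su2 f" "continuous_on {a..b} c"
  shows "smooth_su2 (\<lambda>x. integral {a..b} (\<lambda>t. c t * f (x ** expZ j t)))"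
proof -
  obtain g where g: "\<And>k. Ck k g" "\<And>x. x \<in> SU2 \<Longrightarrow> f x = g x"
    using smooth_su2E[OF assms(1)] by metis
  define A where "A t = Blinfun (\<lambda>x::cmat. x ** expZ j t)" for t
  have A: "blinfun_apply (A t) x = x ** expZ j t" for t x
    unfolding A_def by (simp add: bounded_linear_Blinfun_apply bounded_linear_cmat_mult_right)
  have "continuous_on {a..b} A"
    by (rule continuous_on_blinfun_componentwise) (simp add: A continuous_on_mult_expZ)
  then have "Ck k (\<lambda>x. integral {a..b} (\<lambda>t. c t * g (A t x)))" for k
    using assms(2) g(1) by (rule Ck_integral_compose_blinfun)
  then show ?thesis
    by (rule smooth_su2I) (simp add: A g(2) SU2_mult_expZ)
qed

proposition lider_minus_solvable:
  assumes f: "smooth_su2 f" and \<mu>: "exp (4 * complex_of_real pi * \<mu>) \<noteq> 1"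
  obtains g where "smooth_su2 g" "\<And>x. x \<in> SU2 \<Longrightarrow> lider j g x - \<mu> * g x = f x"
proof
  define c where "c = exp (- \<mu> * complex_of_real (4*pi)) - 1"
  define y where
    "y x = integral {0..4*pi} (\<lambda>t. exp (- \<mu> * complex_of_real t) * f (x ** expZ j t))" for x
  have "c \<noteq> 0"
    using \<mu> by (simp add: c_def exp_minus mult.commute mult.left_commute)
  have smooth_y: "smooth_su2 y"
    unfolding y_def by (intro smooth_su2_integral_mult_expZ f continuous_intros)
  show "smooth_su2 (\<lambda>x. inverse c * y x)"
    by (intro smooth_su2_intros smooth_y)
  fix x assume x: "x \<in> SU2"
  define h where "h t = f (x ** expZ j t)" for t
  have "continuous_on UNIV h"
    unfolding h_def by (intro continuous_on_mult_expZ_compose smooth_su2_imp_continuous_on f x)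
  moreover have "h (t + 4*pi) = h t" for t
    unfolding h_def expZ_add[symmetric] by (simp add: expZ_4pi)
  ultimately have "((\<lambda>s. integral {0..4*pi} (\<lambda>t. exp (- \<mu> * complex_of_real t) * h (s + t)))
      has_vector_derivative \<mu> * y x + c * f x) (at 0)"
    using has_vector_derivative_period_integral[of h "4*pi" \<mu> 0]
    by (simp add: h_def y_def c_def expZ_0)
  then have "lider j y x = \<mu> * y x + c * f x"
    by (intro lider_eqI) (simp add: y_def h_def mult_expZ_add)
  then show "lider j (\<lambda>x. inverse c * y x) x - \<mu> * (inverse c * y x) = f x"
    unfolding lider_cmult[OF smooth_y x] using \<open>c \<noteq> 0\<close> by (simp add: field_simps)
qed

section \<open>The Haar integral\<close>

abbreviation su2_dir :: "complex \<times> complex \<Rightarrow> cmat" where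
  "su2_dir z \<equiv> su2_of ((1 / norm z) *\<^sub>R z)"

abbreviation haar_integrand :: "(cmat \<Rightarrow> complex) \<Rightarrow> complex \<times> complex \<Rightarrow> complex" where
  "haar_integrand f z \<equiv> f (su2_dir z) * complex_of_real (exp (- (norm z)\<^sup>2))"

lemma su2_dir_in_SU2: "z \<noteq> 0 \<Longrightarrow> su2_dir z \<in> SU2"
  by (rule su2_of_in_SU2) simp

lemma AE_su2_dir_in_SU2: "AE z in lborel. su2_dir z \<in> SU2"
  using AE_lborel_singleton[of "0 :: complex \<times> complex"]
  by eventually_elim (rule su2_dir_in_SU2)

lemma AE_su2_dir_off_diagonal: "AE z in lborel. su2_dir z $ 2 $ 1 \<noteq> 0"
proof -
  have "AE x in (lborel::complex measure). AE y in (lborel::complex measure). snd (x, y) \<noteq> 0"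
    using AE_lborel_singleton[of "0::complex"] by simp
  then have "AE z in (lborel::complex measure) \<Otimes>\<^sub>M (lborel::complex measure). snd z \<noteq> 0"
    by (rule lborel_pair.AE_pair_measure[rotated]) measurable
  then have "AE z in (lborel::(complex \<times> complex) measure). snd z \<noteq> 0"
    by (simp only: lborel_prod)
  then show ?thesis
    by eventually_elim (auto simp: su2_of_def)
qed

lemma borel_measurable_haar_integrand:
  assumes "continuous_on SU2 f"
  shows "haar_integrand f \<in> borel_measurable lborel"
proof -
  have "continuous_on (- {0}) (\<lambda>z. f (su2_dir z))"
    by (rule continuous_on_compose2[OF assms], rule continuous_on_compose2[OF continuous_on_su2_of])
       (auto intro!: continuous_intros su2_dir_in_SU2)
  then have "(\<lambda>z. if z \<in> {0} then f (su2_dir 0) else f (su2_dir z)) \<in> borel_measurable borel"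
    by (intro borel_measurable_continuous_on_if) auto
  also have "(\<lambda>z. if z \<in> {0} then f (su2_dir 0) else f (su2_dir z)) = (\<lambda>z. f (su2_dir z))"
    by (rule ext) (metis singletonD)
  finally show ?thesis by measurable
qed

lemma AE_norm_haar_integrand_le:
  assumes "\<And>x. x \<in> SU2 \<Longrightarrow> cmod (f x) \<le> B"
  shows "AE z in lborel. norm (haar_integrand f z) \<le> B * exp (- (norm z)\<^sup>2)"
  using AE_su2_dir_in_SU2
  by eventually_elim (simp add: norm_mult assms)

lemma integrable_haar_integrand:
  assumes "continuous_on SU2 f"
  shows "integrable lborel (haar_integrand f)"
proof -
  obtain B where "B \<ge> 0" and B: "\<And>x. x \<in> SU2 \<Longrightarrow> cmod (f x) \<le> B"
    using continuous_on_SU2_bounded[OF assms] by blast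
  show ?thesis
  proof (rule Bochner_Integration.integrable_bound)
    show "integrable lborel (\<lambda>z::complex \<times> complex. B * exp (- (norm z)\<^sup>2))"
      by (intro integrable_mult_right integrable_exp_minus_norm_power2)
    show "AE z in lborel. norm (haar_integrand f z) \<le> norm (B * exp (- (norm z)\<^sup>2))"
      using AE_norm_haar_integrand_le[OF B] \<open>B \<ge> 0\<close> by simp
  qed (rule borel_measurable_haar_integrand[OF assms])
qed

lemma haar_int_cong:
  assumes "continuous_on SU2 g" "\<And>x. x \<in> SU2 \<Longrightarrow> f x = g x"
  shows "haar_int f = haar_int g"
  unfolding haar_int_def
proof (rule integral_cong_AE)
  have "continuous_on SU2 f"
    using assms continuous_on_cong by metis
  then show "haar_integrand f \<in> borel_measurable lborel"
    by (rule borel_measurable_haar_integrand)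
  show "haar_integrand g \<in> borel_measurable lborel"
    by (rule borel_measurable_haar_integrand[OF assms(1)])
  show "AE z in lborel. haar_integrand f z = haar_integrand g z"
    using AE_su2_dir_in_SU2 by eventually_elim (simp add: assms(2))
qed

lemma haar_int_add:
  assumes "continuous_on SU2 f" "continuous_on SU2 g"
  shows "haar_int (\<lambda>x. f x + g x) = haar_int f + haar_int g"
  unfolding haar_int_def by (simp add: integrable_haar_integrand assms distrib_right)

lemma haar_int_diff:
  assumes "continuous_on SU2 f" "continuous_on SU2 g"
  shows "haar_int (\<lambda>x. f x - g x) = haar_int f - haar_int g"
  unfolding haar_int_def by (simp add: integrable_haar_integrand assms left_diff_distrib)

lemma haar_int_cmult: "haar_int (\<lambda>x. c * f x) = c * haar_int f"
  unfolding haar_int_def by (simp add: mult.assoc)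

lemma haar_int_cnj: "haar_int (\<lambda>x. cnj (f x)) = cnj (haar_int f)"
  unfolding haar_int_def by (subst Bochner_Integration.integral_cnj[symmetric]) simp

lemma haar_int_tendsto:
  assumes cont: "\<And>n. continuous_on SU2 (f n)" "continuous_on SU2 g"
    and bound: "\<And>n x. x \<in> SU2 \<Longrightarrow> cmod (f n x) \<le> B"
    and lim: "\<And>x. x \<in> SU2 \<Longrightarrow> x$2$1 \<noteq> 0 \<Longrightarrow> (\<lambda>n. f n x) \<longlonglongrightarrow> g x"
  shows "(\<lambda>n. haar_int (f n)) \<longlonglongrightarrow> haar_int g"
  unfolding haar_int_def
proof (rule integral_dominated_convergence[where
      w="\<lambda>z::complex \<times> complex. B * exp (- (norm z)\<^sup>2)"])
  show "integrable lborel (\<lambda>z::complex \<times> complex. B * exp (- (norm z)\<^sup>2))"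
    by (intro integrable_mult_right integrable_exp_minus_norm_power2)
  show "AE z in lborel. (\<lambda>n. haar_integrand (f n) z) \<longlonglongrightarrow> haar_integrand g z"
    using AE_su2_dir_in_SU2 AE_su2_dir_off_diagonal
    by eventually_elim (intro tendsto_mult tendsto_const lim)
qed (intro borel_measurable_haar_integrand cont AE_norm_haar_integrand_le bound; assumption)+

lemma continuous_on_SU2_compose_mult_right:
  assumes "continuous_on SU2 f" "U \<in> SU2"
  shows "continuous_on SU2 (\<lambda>x. f (x ** U))"
  by (rule continuous_on_compose2[OF assms(1)
        bounded_linear.continuous_on[OF bounded_linear_cmat_mult_right]])
     (auto intro: SU2_mult assms(2) continuous_on_id)

lemma haar_int_mult_right:
  assumes "continuous_on SU2 f" "U \<in> SU2"
  shows "haar_int (\<lambda>x. f (x ** U)) = haar_int f"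
proof -
  obtain w where "norm w = 1" and U: "U = su2_of w"
    using assms(2) by (rule SU2_E)
  then have R: "orthogonal_transformation (su2_rotation w)"
    by (intro orthogonal_transformation_su2_rotation)
  then have measurable_R: "su2_rotation w \<in> lborel \<rightarrow>\<^sub>M borel"
    by (simp add: borel_measurable_continuous_onI continuous_on_orthogonal_transformation)
  have norm_R: "norm (su2_rotation w z) = norm z" for z
    by (simp add: norm_su2_rotation \<open>norm w = 1\<close>)
  have "su2_dir (su2_rotation w z) = su2_dir z ** U" for z
    by (simp only: U su2_of_mult norm_R orthogonal_transformation_scaleR[OF R])
  then have "haar_int (\<lambda>x. f (x ** U)) = (LINT z|lborel. haar_integrand f (su2_rotation w z))"
    by (simp only: haar_int_def norm_R)
  also have "\<dots> = integral\<^sup>L (distr lborel borel (su2_rotation w)) (haar_integrand f)"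
    using borel_measurable_haar_integrand[OF assms(1)]
    by (intro integral_distr[symmetric] measurable_R) simp
  also have "\<dots> = haar_int f"
    by (simp only: lborel_distr_orthogonal_transformation[OF R] haar_int_def)
  finally show ?thesis .
qed

lemma has_vector_derivative_imp_tendsto_quotient:
  assumes "(f has_vector_derivative d) (at x)"
  shows "((\<lambda>y. (f y - f x) /\<^sub>R (y - x)) \<longlongrightarrow> d) (at x)"
proof -
  have "((\<lambda>y. norm (f y - f x - (y - x) *\<^sub>R d) / norm (y - x)) \<longlongrightarrow> 0) (at x)"
    using assms unfolding has_vector_derivative_def has_derivative_iff_norm by simp
  moreover have "\<forall>\<^sub>F y in at x. norm (f y - f x - (y - x) *\<^sub>R d) / norm (y - x) =
      norm ((f y - f x) /\<^sub>R (y - x) - d)"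
    unfolding eventually_at_filter
  proof (intro always_eventually allI impI)
    fix y assume "y \<noteq> x"
    then have "(f y - f x) /\<^sub>R (y - x) - d = (f y - f x - (y - x) *\<^sub>R d) /\<^sub>R (y - x)"
      by (simp add: scaleR_diff_right)
    then show "norm (f y - f x - (y - x) *\<^sub>R d) / norm (y - x) =
        norm ((f y - f x) /\<^sub>R (y - x) - d)"
      by (simp add: divide_inverse mult.commute)
  qed
  ultimately have "((\<lambda>y. norm ((f y - f x) /\<^sub>R (y - x) - d)) \<longlongrightarrow> 0) (at x)"
    by (rule Lim_transform_eventually)
  then show ?thesis
    by (simp add: Lim_null[of _ d] tendsto_norm_zero_iff)
qed

lemma cmod_mult_expZ_diff_le:
  assumes f: "smooth_su2 f" and x: "x \<in> SU2" and B: "\<And>y. y \<in> SU2 \<Longrightarrow> cmod (lider j f y) \<le> B"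
    and "0 < t"
  shows "cmod (f (x ** expZ j t) - f x) \<le> B * t"
proof -
  obtain s where "norm (f (x ** expZ j t) - f (x ** expZ j 0)) \<le>
      norm ((t - 0) *\<^sub>R lider j f (x ** expZ j s))"
    using mvt_general[OF \<open>0 < t\<close>
        continuous_on_mult_expZ_compose[OF smooth_su2_imp_continuous_on[OF f] x]
        has_vector_derivative_lider[OF f x, unfolded has_vector_derivative_def]] by blast
  also have "\<dots> \<le> B * t"
    using \<open>0 < t\<close> B[OF SU2_mult_expZ[OF x]] by (simp add: mult.commute)
  finally show ?thesis by (simp add: expZ_0)
qed

lemma lider_tendsto_quotient:
  assumes "smooth_su2 f" "x \<in> SU2"
  shows "((\<lambda>t. (f (x ** expZ j t) - f x) /\<^sub>R t) \<longlongrightarrow> lider j f x) (at 0)"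
  using has_vector_derivative_imp_tendsto_quotient[OF has_vector_derivative_lider_at_0[OF assms]]
  by (simp add: expZ_0)

lemma haar_int_lider:
  assumes f: "smooth_su2 f"
  shows "haar_int (lider j f) = 0"
proof -
  define \<epsilon> where "\<epsilon> n = inverse (real (Suc n))" for n
  define Q where "Q n x = complex_of_real (inverse (\<epsilon> n)) * (f (x ** expZ j (\<epsilon> n)) - f x)" for n x
  have \<epsilon>_pos: "\<epsilon> n > 0" for n
    by (simp add: \<epsilon>_def)
  have \<epsilon>_lim: "filterlim \<epsilon> (at 0) sequentially"
    using LIMSEQ_inverse_real_of_nat \<epsilon>_pos unfolding \<epsilon>_def by (simp add: filterlim_at)
  have cont: "continuous_on SU2 f" "continuous_on SU2 (lider j f)"
    by (intro smooth_su2_imp_continuous_on smooth_su2_lider f)+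
  have cont_shift: "continuous_on SU2 (\<lambda>x. f (x ** expZ j t))" for t
    by (intro continuous_on_SU2_compose_mult_right cont(1) expZ_in_SU2)
  obtain B where B: "\<And>x. x \<in> SU2 \<Longrightarrow> cmod (lider j f x) \<le> B"
    using continuous_on_SU2_bounded[OF cont(2)] by blast
  have "(\<lambda>n. haar_int (Q n)) \<longlonglongrightarrow> haar_int (lider j f)"
  proof (rule haar_int_tendsto)
    show "continuous_on SU2 (Q n)" for n
      unfolding Q_def by (intro continuous_intros cont cont_shift)
    show "cmod (Q n x) \<le> B" if "x \<in> SU2" for n x
      using cmod_mult_expZ_diff_le[OF f that B \<epsilon>_pos, of n] \<epsilon>_pos[of n]
      by (simp add: Q_def norm_divide field_simps)
    show "(\<lambda>n. Q n x) \<longlonglongrightarrow> lider j f x" if "x \<in> SU2" for x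
      using filterlim_compose[OF lider_tendsto_quotient[OF f that] \<epsilon>_lim, of j]
      by (simp add: Q_def scaleR_conv_of_real)
  qed (rule cont(2))
  moreover have "haar_int (Q n) = 0" for n
    unfolding Q_def haar_int_cmult
    by (simp add: haar_int_diff cont(1) cont_shift haar_int_mult_right expZ_in_SU2)
  ultimately show ?thesis
    by (simp add: LIMSEQ_const_iff)
qed

lemma haar_int_diagonal_power_tendsto_0:
  assumes "continuous_on SU2 f"
  shows "(\<lambda>n. haar_int (\<lambda>x. f x * (x$1$1 * x$2$2) ^ n)) \<longlonglongrightarrow> 0"
proof -
  obtain B where "B \<ge> 0" and B: "\<And>x. x \<in> SU2 \<Longrightarrow> cmod (f x) \<le> B"
    using continuous_on_SU2_bounded[OF assms] by blast
  have "(\<lambda>n. haar_int (\<lambda>x. f x * (x$1$1 * x$2$2) ^ n)) \<longlonglongrightarrow> haar_int (\<lambda>x. 0)"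
  proof (rule haar_int_tendsto)
    show "continuous_on SU2 (\<lambda>x. f x * (x$1$1 * x$2$2) ^ n)" for n
      by (intro continuous_intros assms)
    show "cmod (f x * (x$1$1 * x$2$2) ^ n) \<le> B" if "x \<in> SU2" for n x
    proof -
      have "cmod (x$1$1 * x$2$2) ^ n \<le> 1"
        by (intro power_le_one norm_ge_zero) (simp add: cmod_SU2_diagonal_product[OF that])
      then show ?thesis
        using mult_mono[OF B[OF that] _ \<open>B \<ge> 0\<close>, of "cmod (x$1$1 * x$2$2) ^ n" 1]
        by (simp add: norm_mult norm_power)
    qed
    show "(\<lambda>n. f x * (x$1$1 * x$2$2) ^ n) \<longlonglongrightarrow> 0" if "x \<in> SU2" "x$2$1 \<noteq> 0" for x
      using cmod_SU2_diagonal_product[OF that(1)] that(2)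
      by (intro tendsto_mult_right_zero LIMSEQ_power_zero) simp
  qed auto
  then show ?thesis by (simp add: haar_int_def)
qed

section \<open>Functionals and densities\<close>

lemma liderw_cong:
  assumes "\<And>y. y \<in> SU2 \<Longrightarrow> f y = g y" "x \<in> SU2"
  shows "liderw w f x = liderw w g x"
  using assms(2) by (induction w arbitrary: x) (auto intro: lider_cong assms(1))

lemma liderw_zero: "liderw w (\<lambda>x. 0) = (\<lambda>x. 0)"
  by (induction w) (auto simp: lider_const intro: ext)

lemma seminorm_k_eq_0:
  assumes "\<And>x. x \<in> SU2 \<Longrightarrow> f x = 0"
  shows "seminorm_k k f = 0"
proof -
  have "(\<lambda>x. cmod (liderw w f x)) ` SU2 = {0}" for w
    using liderw_cong[of f "\<lambda>x. 0" _ w] assms mat1_in_SU2 by (auto simp: liderw_zero image_iff)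
  then show ?thesis by (simp add: seminorm_k_def)
qed

lemma cmod_le_seminorm_k_0:
  assumes "continuous_on SU2 f" "x \<in> SU2"
  shows "cmod (f x) \<le> seminorm_k 0 f"
proof -
  obtain M where M: "\<And>x. x \<in> SU2 \<Longrightarrow> cmod (f x) \<le> M"
    using continuous_on_SU2_bounded[OF assms(1)] by blast
  have "{v. length v \<le> 0 \<and> set v \<subseteq> {1, 2, 3}} = {[] :: nat list}"
    by auto
  then have "seminorm_k 0 f = (SUP x\<in>SU2. cmod (f x))"
    by (simp add: seminorm_k_def)
  then show ?thesis
    using M assms(2) by (metis cSUP_upper bdd_aboveI2)
qed

definition linear_on_smooth :: "((cmat \<Rightarrow> complex) \<Rightarrow> complex) \<Rightarrow> bool" where
  "linear_on_smooth u \<longleftrightarrow>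
    (\<forall>f g a b. smooth_su2 f \<longrightarrow> smooth_su2 g \<longrightarrow> u (\<lambda>x. a * f x + b * g x) = a * u f + b * u g) \<and>
    (\<forall>f g. smooth_su2 f \<longrightarrow> (\<forall>x\<in>SU2. g x = f x) \<longrightarrow> u g = u f)"

lemma linear_on_smoothD:
  assumes "linear_on_smooth u" "smooth_su2 f" "smooth_su2 g"
  shows "u (\<lambda>x. a * f x + b * g x) = a * u f + b * u g"
  using assms unfolding linear_on_smooth_def by blast

lemma linear_on_smooth_cong:
  assumes "linear_on_smooth u" "smooth_su2 f" "\<And>x. x \<in> SU2 \<Longrightarrow> g x = f x"
  shows "u g = u f"
  using assms unfolding linear_on_smooth_def by blast

lemma is_dist_imp_linear_on_smooth:
  assumes "is_dist u"
  shows "linear_on_smooth u"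
proof -
  have linear: "u (\<lambda>x. a * f x + b * g x) = a * u f + b * u g" if "smooth_su2 f" "smooth_su2 g"
    for f g a b
    using assms that unfolding is_dist_def by blast
  obtain C k where C: "\<And>h. smooth_su2 h \<Longrightarrow> cmod (u h) \<le> C * seminorm_k k h"
    using assms unfolding is_dist_def by blast
  have "u g = u f" if f: "smooth_su2 f" and eq: "\<forall>x\<in>SU2. g x = f x" for f g
  proof -
    have g: "smooth_su2 g"
      using eq by (intro smooth_su2_cong[OF f]) simp
    have "cmod (u (\<lambda>x. 1 * g x + (-1) * f x)) \<le> C * 0"
      using C[of "\<lambda>x. 1 * g x + (-1) * f x"] eq
      by (simp add: seminorm_k_eq_0 smooth_su2_diff f g)
    then show ?thesis
      using linear[OF g f, of 1 "-1"] by simp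
  qed
  with linear show ?thesis
    unfolding linear_on_smooth_def by blast
qed

definition partial0_minus :: "complex \<Rightarrow> (cmat \<Rightarrow> complex) \<Rightarrow> cmat \<Rightarrow> complex" where
  "partial0_minus z f x = partial0 f x - z * f x"

definition dpartial0_minus ::
  "complex \<Rightarrow> ((cmat \<Rightarrow> complex) \<Rightarrow> complex) \<Rightarrow> (cmat \<Rightarrow> complex) \<Rightarrow> complex" where
  "dpartial0_minus z u \<phi> = dpartial0 u \<phi> - z * u \<phi>"

lemma smooth_su2_partial0_minus: "smooth_su2 f \<Longrightarrow> smooth_su2 (partial0_minus z f)"
  unfolding partial0_minus_def by (intro smooth_su2_intros)

lemma partial0_minus_solvable:
  assumes "smooth_su2 f" "exp (4 * complex_of_real pi * z) \<noteq> 1"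
  obtains g where "smooth_su2 g" "\<And>x. x \<in> SU2 \<Longrightarrow> partial0_minus z g x = f x"
  using lider_minus_solvable[OF assms, of 3] unfolding partial0_minus_def by metis

lemma dpartial0_minus_apply:
  assumes u: "linear_on_smooth u" and f: "smooth_su2 f"
  shows "dpartial0_minus z u f = - u (partial0_minus (- z) f)"
proof -
  have "partial0_minus (- z) f = (\<lambda>x. 1 * partial0 f x + z * f x)"
    by (simp add: partial0_minus_def fun_eq_iff)
  then show ?thesis
    using linear_on_smoothD[OF u smooth_su2_lider[OF f] f, of 1 3 z]
    by (simp add: dpartial0_minus_def dpartial0_def)
qed

lemma linear_on_smooth_dpartial0_minus:
  assumes u: "linear_on_smooth u"
  shows "linear_on_smooth (dpartial0_minus z u)"
  unfolding linear_on_smooth_def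
proof (intro conjI allI impI)
  fix f g a b assume smooth: "smooth_su2 f" "smooth_su2 g"
  have "u (partial0 (\<lambda>x. a * f x + b * g x)) = u (\<lambda>x. a * partial0 f x + b * partial0 g x)"
    by (intro linear_on_smooth_cong[OF u] smooth_su2_intros smooth)
       (simp add: lider_add lider_cmult smooth_su2_intros smooth)
  then show "dpartial0_minus z u (\<lambda>x. a * f x + b * g x) =
      a * dpartial0_minus z u f + b * dpartial0_minus z u g"
    by (simp add: dpartial0_minus_def dpartial0_def linear_on_smoothD[OF u] smooth_su2_lider smooth
        algebra_simps)
next
  fix f g :: "cmat \<Rightarrow> complex" assume f: "smooth_su2 f" and eq: "\<forall>x\<in>SU2. g x = f x"
  have "u g = u f" "u (partial0 g) = u (partial0 f)"
    using eq by (auto intro!: linear_on_smooth_cong[OF u] lider_cong smooth_su2_lider f)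
  then show "dpartial0_minus z u g = dpartial0_minus z u f"
    by (simp add: dpartial0_minus_def dpartial0_def)
qed

lemma eq_on_smooth_if_dpartial0_minus_eq:
  assumes u: "linear_on_smooth u" and v: "linear_on_smooth v"
    and z: "exp (4 * complex_of_real pi * z) \<noteq> 1"
    and eq: "\<And>\<phi>. smooth_su2 \<phi> \<Longrightarrow> dpartial0_minus z u \<phi> = dpartial0_minus z v \<phi>"
    and \<phi>: "smooth_su2 \<phi>"
  shows "u \<phi> = v \<phi>"
proof -
  have "exp (4 * complex_of_real pi * - z) \<noteq> 1"
    using z by (simp add: exp_minus)
  then obtain g where g: "smooth_su2 g" "\<And>x. x \<in> SU2 \<Longrightarrow> partial0_minus (- z) g x = \<phi> x"
    by (rule partial0_minus_solvable[OF \<phi>]) blast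
  have "w \<phi> = - dpartial0_minus z w g" if w: "linear_on_smooth w" for w
    using linear_on_smooth_cong[OF w \<phi> g(2)] by (simp add: dpartial0_minus_apply[OF w g(1)])
  from this[OF u] this[OF v] show ?thesis
    by (simp add: eq[OF g(1)])
qed

locale partial0_invariant_integral =
  fixes I :: "(cmat \<Rightarrow> complex) \<Rightarrow> complex"
  assumes I_cong: "smooth_su2 g \<Longrightarrow> (\<And>x. x \<in> SU2 \<Longrightarrow> f x = g x) \<Longrightarrow> I f = I g"
    and I_add: "smooth_su2 f \<Longrightarrow> smooth_su2 g \<Longrightarrow> I (\<lambda>x. f x + g x) = I f + I g"
    and I_cmult: "smooth_su2 f \<Longrightarrow> I (\<lambda>x. c * f x) = c * I f"
    and I_cnj: "I (\<lambda>x. cnj (f x)) = cnj (I f)"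
    and I_partial0: "smooth_su2 f \<Longrightarrow> I (partial0 f) = 0"
begin

definition has_density :: "((cmat \<Rightarrow> complex) \<Rightarrow> complex) \<Rightarrow> (cmat \<Rightarrow> complex) \<Rightarrow> bool" where
  "has_density u f \<longleftrightarrow> (\<forall>\<phi>. smooth_su2 \<phi> \<longrightarrow> u \<phi> = I (\<lambda>x. f x * \<phi> x))"

lemma has_densityI:
  assumes "\<And>\<phi>. smooth_su2 \<phi> \<Longrightarrow> u \<phi> = I (\<lambda>x. f x * \<phi> x)"
  shows "has_density u f"
  using assms by (simp add: has_density_def)

lemma has_densityD: "has_density u f \<Longrightarrow> smooth_su2 \<phi> \<Longrightarrow> u \<phi> = I (\<lambda>x. f x * \<phi> x)"
  by (simp add: has_density_def)

lemma integral_by_parts: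
  assumes "smooth_su2 f" "smooth_su2 g"
  shows "I (\<lambda>x. partial0 f x * g x) = - I (\<lambda>x. f x * partial0 g x)"
proof -
  have "I (\<lambda>x. f x * partial0 g x) + I (\<lambda>x. partial0 f x * g x) =
      I (\<lambda>x. f x * partial0 g x + partial0 f x * g x)"
    using assms by (intro I_add[symmetric] smooth_su2_intros)
  also have "\<dots> = I (partial0 (\<lambda>x. f x * g x))"
    using assms by (intro I_cong[symmetric] lider_mult smooth_su2_intros)
  also have "\<dots> = 0"
    using assms by (intro I_partial0 smooth_su2_mult)
  finally show ?thesis
    by (simp add: add_eq_0_iff)
qed

lemma linear_on_smooth_density:
  assumes "smooth_su2 f"
  shows "linear_on_smooth (\<lambda>\<phi>. I (\<lambda>x. f x * \<phi> x))"
  unfolding linear_on_smooth_def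
proof (intro conjI allI impI)
  fix g h a b assume smooth: "smooth_su2 g" "smooth_su2 h"
  have "I (\<lambda>x. f x * (a * g x + b * h x)) = I (\<lambda>x. a * (f x * g x) + b * (f x * h x))"
    by (simp add: algebra_simps)
  also have "\<dots> = a * I (\<lambda>x. f x * g x) + b * I (\<lambda>x. f x * h x)"
    by (simp add: I_add I_cmult smooth_su2_intros assms smooth)
  finally show "I (\<lambda>x. f x * (a * g x + b * h x)) = a * I (\<lambda>x. f x * g x) + b * I (\<lambda>x. f x * h x)" .
qed (auto intro!: I_cong smooth_su2_intros assms)

lemma has_density_dpartial0:
  assumes "has_density u f" "smooth_su2 f"
  shows "has_density (dpartial0 u) (partial0 f)"
  using assms
  by (intro has_densityI) (simp add: dpartial0_def has_densityD smooth_su2_lider integral_by_parts)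

lemma has_density_dconj:
  assumes "has_density u f"
  shows "has_density (dconj u) (\<lambda>x. cnj (f x))"
proof (rule has_densityI)
  fix \<phi> assume "smooth_su2 \<phi>"
  then have "dconj u \<phi> = cnj (I (\<lambda>x. f x * cnj (\<phi> x)))"
    by (simp add: dconj_def has_densityD[OF assms] smooth_su2_cnj)
  then show "dconj u \<phi> = I (\<lambda>x. cnj (f x) * \<phi> x)"
    by (simp flip: I_cnj)
qed

lemma has_density_linear_combination:
  assumes "has_density u f" "smooth_su2 f" "has_density v g" "smooth_su2 g"
  shows "has_density (\<lambda>\<phi>. a * u \<phi> + b * v \<phi>) (\<lambda>x. a * f x + b * g x)"
proof (rule has_densityI)
  fix \<phi> assume \<phi>: "smooth_su2 \<phi>"
  show "a * u \<phi> + b * v \<phi> = I (\<lambda>x. (a * f x + b * g x) * \<phi> x)"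
    using linear_on_smoothD[OF linear_on_smooth_density[OF \<phi>] assms(2,4)]
    by (simp add: has_densityD[OF assms(1) \<phi>] has_densityD[OF assms(3) \<phi>] mult.commute)
qed

lemma has_density_dpartial0_minus:
  assumes "has_density u f" "smooth_su2 f"
  shows "has_density (dpartial0_minus z u) (partial0_minus z f)"
  using has_density_linear_combination[OF has_density_dpartial0[OF assms]
      smooth_su2_lider[OF assms(2)] assms, of 1 "- z"]
  by (simp add: dpartial0_minus_def[abs_def] partial0_minus_def[abs_def])

lemma has_density_dpartial0_minus_add_dconj:
  assumes "has_density u f" "smooth_su2 f" "has_density v g" "smooth_su2 g"
  shows "has_density (\<lambda>\<phi>. dpartial0_minus z u \<phi> + c * dconj v \<phi>)
    (\<lambda>x. partial0_minus z f x + c * cnj (g x))"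
  using has_density_linear_combination[OF has_density_dpartial0_minus[OF assms(1,2)]
      smooth_su2_partial0_minus[OF assms(2)] has_density_dconj[OF assms(3)]
      smooth_su2_cnj[OF assms(4)],
      of 1 z c]
  by simp

end

interpretation haar: partial0_invariant_integral haar_int
proof
  show "haar_int f = haar_int g" if "smooth_su2 g" "\<And>x. x \<in> SU2 \<Longrightarrow> f x = g x" for f g
    using smooth_su2_imp_continuous_on[OF that(1)] that(2) by (rule haar_int_cong)
qed (simp_all add: haar_int_add haar_int_cmult haar_int_cnj haar_int_lider
    smooth_su2_imp_continuous_on)

lemma smooth_dist_iff_has_density: "smooth_dist u \<longleftrightarrow> (\<exists>f. smooth_su2 f \<and> haar.has_density u f)"
  by (simp add: smooth_dist_def haar.has_density_def)

section \<open>Sufficiency\<close>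

lemma smooth_dist_if_smooth_dist_dpartial0_minus:
  assumes u: "linear_on_smooth u" and z: "exp (4 * complex_of_real pi * z) \<noteq> 1"
    and smooth: "smooth_dist (dpartial0_minus z u)"
  shows "smooth_dist u"
proof -
  obtain f where f: "smooth_su2 f" "haar.has_density (dpartial0_minus z u) f"
    using smooth unfolding smooth_dist_iff_has_density by blast
  obtain g where g: "smooth_su2 g" "\<And>x. x \<in> SU2 \<Longrightarrow> partial0_minus z g x = f x"
    using partial0_minus_solvable[OF f(1) z] by blast
  define v where "v \<phi> = haar_int (\<lambda>x. g x * \<phi> x)" for \<phi>
  have v: "haar.has_density v g"
    by (simp add: v_def haar.has_densityI)
  have eq: "dpartial0_minus z u \<phi> = dpartial0_minus z v \<phi>" if \<phi>: "smooth_su2 \<phi>" for \<phi>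
  proof -
    have "haar_int (\<lambda>x. partial0_minus z g x * \<phi> x) = haar_int (\<lambda>x. f x * \<phi> x)"
      by (rule haar.I_cong) (simp_all add: g(2) smooth_su2_mult f(1) \<phi>)
    then show ?thesis
      using haar.has_densityD[OF f(2) \<phi>]
        haar.has_densityD[OF haar.has_density_dpartial0_minus[OF v g(1)] \<phi>]
      by simp
  qed
  have "linear_on_smooth v"
    unfolding v_def by (rule haar.linear_on_smooth_density[OF g(1)])
  from eq_on_smooth_if_dpartial0_minus_eq[OF u this z eq] have "haar.has_density u g"
    by (simp add: haar.has_density_def v_def)
  then show ?thesis
    using g(1) smooth_dist_iff_has_density by blast
qed

lemma Pop_eq: "Pop p q u \<phi> = dpartial0_minus q u \<phi> - p * dconj u \<phi>"
  by (simp add: Pop_def dpartial0_minus_def)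

lemma Pop_eliminate_conjugate:
  assumes u: "linear_on_smooth u" and \<phi>: "smooth_su2 \<phi>"
    and sum: "z1 + z2 = complex_of_real (2 * Re q)"
    and prod: "z1 * z2 = complex_of_real ((cmod q)\<^sup>2 - (cmod p)\<^sup>2)"
  shows "dpartial0_minus z1 (dpartial0_minus z2 u) \<phi> =
    dpartial0_minus (cnj q) (Pop p q u) \<phi> + p * dconj (Pop p q u) \<phi>"
proof -
  have "u (partial0 (\<lambda>x. cnj (\<phi> x))) = u (\<lambda>x. cnj (partial0 \<phi> x))"
    by (intro linear_on_smooth_cong[OF u] smooth_su2_intros lider_cnj \<phi>)
  then have "dpartial0_minus (cnj q) (Pop p q u) \<phi> + p * dconj (Pop p q u) \<phi> =
      u (partial0 (partial0 \<phi>)) + (q + cnj q) * u (partial0 \<phi>) + (q * cnj q - p * cnj p) * u \<phi>"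
    by (simp add: dpartial0_minus_def Pop_def dpartial0_def dconj_def algebra_simps)
  also have "q + cnj q = z1 + z2"
    by (simp only: sum complex_add_cnj)
  also have "q * cnj q - p * cnj p = z1 * z2"
    by (simp only: prod of_real_diff complex_norm_square)
  finally show ?thesis
    by (simp add: dpartial0_minus_def dpartial0_def algebra_simps)
qed

lemma complex_numbers_with_sum_and_product:
  obtains z1 z2 :: complex where "z1 + z2 = s" "z1 * z2 = t"
proof
  define d where "d = csqrt ((s/2)\<^sup>2 - t)"
  have "d\<^sup>2 = (s/2)\<^sup>2 - t"
    by (simp add: d_def)
  then show "(s/2 + d) + (s/2 - d) = s" "(s/2 + d) * (s/2 - d) = t"
    by (simp_all add: field_simps power2_eq_square)
qed

lemma exp_4pi_eq_1D:
  assumes "exp (4 * complex_of_real pi * z) = 1"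
  obtains n :: int where "z = \<i> * complex_of_real (of_int n / 2)"
proof -
  obtain n :: int where "4 * pi * Re z = 0" "4 * pi * Im z = of_int (2 * n) * pi"
    using assms by (auto simp: exp_eq_1)
  then have "z = \<i> * complex_of_real (of_int n / 2)"
    by (simp add: complex_eq_iff field_simps)
  then show thesis by (rule that)
qed

definition Delta :: "complex \<Rightarrow> complex \<Rightarrow> real \<Rightarrow> complex" where
  "Delta p q m = - (complex_of_real m)\<^sup>2 + (complex_of_real (cmod q))\<^sup>2 - (complex_of_real (cmod p))\<^sup>2
     - 2 * \<i> * complex_of_real m * complex_of_real (Re q)"

lemma Delta_eq_quadratic:
  "Delta p q m = (\<i> * m)\<^sup>2 - complex_of_real (2 * Re q) * (\<i> * m)
     + complex_of_real ((cmod q)\<^sup>2 - (cmod p)\<^sup>2)"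
  by (simp add: Delta_def power_mult_distrib algebra_simps)

lemma Delta_eq_determinant: "Delta p q m = (\<i> * m - q) * (\<i> * m - cnj q) - p * cnj p"
  unfolding Delta_eq_quadratic of_real_diff complex_norm_square complex_add_cnj[symmetric]
  by (simp add: algebra_simps power2_eq_square)

theorem globally_hypoelliptic_Pop_if_Delta_nonzero:
  assumes nonzero: "\<And>n::int. Delta p q (of_int n / 2) \<noteq> 0"
  shows "globally_hypoelliptic (Pop p q)"
  unfolding globally_hypoelliptic_def
proof (intro allI impI)
  fix u assume "is_dist u" and "smooth_dist (Pop p q u)"
  then have u: "linear_on_smooth u"
    by (intro is_dist_imp_linear_on_smooth)
  obtain f where f: "haar.has_density (Pop p q u) f" "smooth_su2 f"
    using \<open>smooth_dist (Pop p q u)\<close> unfolding smooth_dist_iff_has_density by blast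
  obtain z1 z2 where z: "z1 + z2 = complex_of_real (2 * Re q)"
      "z1 * z2 = complex_of_real ((cmod q)\<^sup>2 - (cmod p)\<^sup>2)"
    by (rule complex_numbers_with_sum_and_product)
  have Delta_factor: "Delta p q m = (\<i> * m - z1) * (\<i> * m - z2)" for m
    unfolding Delta_eq_quadratic z[symmetric] by (simp add: algebra_simps power2_eq_square)
  have nonresonant: "exp (4 * complex_of_real pi * z) \<noteq> 1" if "z = z1 \<or> z = z2" for z
  proof
    assume "exp (4 * complex_of_real pi * z) = 1"
    then obtain n :: int where "z = \<i> * complex_of_real (of_int n / 2)"
      by (rule exp_4pi_eq_1D)
    then have "Delta p q (of_int n / 2) = 0"
      using that unfolding Delta_factor by force
    with nonzero show False by blast
  qed
  have "haar.has_density (dpartial0_minus z1 (dpartial0_minus z2 u))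
      (\<lambda>x. partial0_minus (cnj q) f x + p * cnj (f x))"
    using haar.has_density_dpartial0_minus_add_dconj[OF f f, of "cnj q" p]
    by (simp add: haar.has_density_def Pop_eliminate_conjugate[OF u _ z])
  moreover have "smooth_su2 (\<lambda>x. partial0_minus (cnj q) f x + p * cnj (f x))"
    by (intro smooth_su2_intros smooth_su2_partial0_minus f(2))
  ultimately have "smooth_dist (dpartial0_minus z1 (dpartial0_minus z2 u))"
    unfolding smooth_dist_iff_has_density by blast
  then show "smooth_dist u"
    using nonresonant u
    by (blast intro: smooth_dist_if_smooth_dist_dpartial0_minus linear_on_smooth_dpartial0_minus)
qed

section \<open>Necessity\<close>

definition torus_int :: "(cmat \<Rightarrow> complex) \<Rightarrow> complex" where
  "torus_int f = integral {0..4*pi} (\<lambda>t. f (expZ 3 t))"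

lemma continuous_on_torus:
  assumes "smooth_su2 f"
  shows "continuous_on S (\<lambda>t. f (expZ j t))"
  using continuous_on_mult_expZ_compose[OF smooth_su2_imp_continuous_on[OF assms] mat1_in_SU2]
  by simp

lemma integrable_on_torus:
  assumes "smooth_su2 f"
  shows "(\<lambda>t. f (expZ j t)) integrable_on {a..b}"
  by (intro integrable_continuous_real continuous_on_torus assms)

lemma torus_int_partial0:
  assumes "smooth_su2 f"
  shows "torus_int (partial0 f) = 0"
proof -
  have "((\<lambda>t. partial0 f (expZ 3 t)) has_integral f (expZ 3 (4*pi)) - f (expZ 3 0)) {0..4*pi}"
    using has_vector_derivative_lider[OF assms mat1_in_SU2, of 3]
    by (intro fundamental_theorem_of_calculus) (auto intro: has_vector_derivative_at_within)
  then show ?thesis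
    by (simp add: torus_int_def integral_unique expZ_0 expZ_4pi)
qed

interpretation torus: partial0_invariant_integral torus_int
proof
  show "torus_int f = torus_int g" if "\<And>x. x \<in> SU2 \<Longrightarrow> f x = g x" for f g
    by (simp add: torus_int_def that expZ_in_SU2)
  show "torus_int (\<lambda>x. f x + g x) = torus_int f + torus_int g"
    if "smooth_su2 f" "smooth_su2 g" for f g
    unfolding torus_int_def by (intro integral_add integrable_on_torus that)
  show "torus_int (\<lambda>x. c * f x) = c * torus_int f" for c f
    by (simp add: torus_int_def)
  show "torus_int (\<lambda>x. cnj (f x)) = cnj (torus_int f)" for f
    by (simp add: torus_int_def integral_cnj)
qed (rule torus_int_partial0)

lemma is_dist_torus_density:
  assumes f: "smooth_su2 f"
  shows "is_dist (\<lambda>\<phi>. torus_int (\<lambda>x. f x * \<phi> x))"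
proof -
  obtain B where "B \<ge> 0" and B: "\<And>x. x \<in> SU2 \<Longrightarrow> cmod (f x) \<le> B"
    using continuous_on_SU2_bounded[OF smooth_su2_imp_continuous_on[OF f]] by blast
  have "cmod (torus_int (\<lambda>x. f x * \<phi> x)) \<le> (B * (4*pi)) * seminorm_k 0 \<phi>" if \<phi>: "smooth_su2 \<phi>" for \<phi>
  proof -
    have "cmod (torus_int (\<lambda>x. f x * \<phi> x)) \<le> (B * seminorm_k 0 \<phi>) * (4*pi - 0)"
      unfolding torus_int_def
    proof (rule integral_bound)
      show "cmod (f (expZ 3 t) * \<phi> (expZ 3 t)) \<le> B * seminorm_k 0 \<phi>" for t
        unfolding norm_mult using \<open>B \<ge> 0\<close>
        by (intro mult_mono B cmod_le_seminorm_k_0 smooth_su2_imp_continuous_on expZ_in_SU2 \<phi>) auto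
    qed (auto intro!: continuous_on_torus smooth_su2_mult f \<phi>)
    then show ?thesis by (simp add: mult_ac)
  qed
  moreover note torus.linear_on_smooth_density[OF f]
  ultimately show ?thesis
    unfolding is_dist_def linear_on_smooth_def by blast
qed

text \<open>Multiplying by \<open>(x$1$1 * x$2$2) ^ n\<close> does not change a density on the torus, but concentrates
  the Haar integral on the torus, a null set.\<close>

lemma not_smooth_dist_torus_density:
  assumes f: "smooth_su2 f" and "f (mat 1) \<noteq> 0"
  shows "\<not> smooth_dist (\<lambda>\<phi>. torus_int (\<lambda>x. f x * \<phi> x))"
proof
  assume "smooth_dist (\<lambda>\<phi>. torus_int (\<lambda>x. f x * \<phi> x))"
  then obtain g where g: "smooth_su2 g" "haar.has_density (\<lambda>\<phi>. torus_int (\<lambda>x. f x * \<phi> x)) g"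
    unfolding smooth_dist_iff_has_density by blast
  have "haar_int (\<lambda>x. (g x * cnj (f x)) * (x$1$1 * x$2$2) ^ n) =
      torus_int (\<lambda>x. f x * cnj (f x))" for n
  proof -
    have "torus_int (\<lambda>x. f x * cnj (f x)) = torus_int (\<lambda>x. f x * (cnj (f x) * (x$1$1 * x$2$2) ^ n))"
      by (simp add: torus_int_def expZ_3_entries cis_mult)
    also have "\<dots> = haar_int (\<lambda>x. g x * (cnj (f x) * (x$1$1 * x$2$2) ^ n))"
      by (intro haar.has_densityD[OF g(2)] smooth_su2_intros f)
    finally show ?thesis by (simp add: mult.assoc)
  qed
  moreover have "(\<lambda>n. haar_int (\<lambda>x. (g x * cnj (f x)) * (x$1$1 * x$2$2) ^ n)) \<longlonglongrightarrow> 0"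
    by (intro haar_int_diagonal_power_tendsto_0 smooth_su2_imp_continuous_on smooth_su2_intros f g(1))
  ultimately have "torus_int (\<lambda>x. f x * cnj (f x)) = 0"
    by (simp add: LIMSEQ_const_iff)
  moreover have "torus_int (\<lambda>x. f x * cnj (f x)) =
      complex_of_real (integral {0..4*pi} (\<lambda>t. (cmod (f (expZ 3 t)))\<^sup>2))"
    unfolding torus_int_def complex_norm_square[symmetric] of_real_power[symmetric]
    by (rule integral_linear[OF _ bounded_linear_of_real, unfolded o_def])
       (intro integrable_continuous_real continuous_intros continuous_on_torus f)
  ultimately have "\<forall>t\<in>{0..4*pi}. (cmod (f (expZ 3 t)))\<^sup>2 = 0"
    by (subst integral_eq_0_iff[symmetric]) (auto intro!: continuous_intros continuous_on_torus f)
  then have "f (expZ 3 0) = 0" by simp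
  then show False
    using \<open>f (mat 1) \<noteq> 0\<close> by (simp add: expZ_0)
qed

definition torus_weight :: "nat \<Rightarrow> nat \<Rightarrow> cmat \<Rightarrow> complex" where
  "torus_weight L k x = x$1$1 ^ L * x$2$2 ^ (2 * k)"

lemma smooth_su2_torus_weight: "smooth_su2 (torus_weight L k)"
  unfolding torus_weight_def by (intro smooth_su2_intros)

lemma torus_weight_mult_expZ:
  "torus_weight L k (x ** expZ 3 t) = cis ((real L / 2 - real k) * t) * torus_weight L k x"
proof -
  have "cis ((real L / 2 - real k) * t) = cis (real L * (t/2)) * cis (real (2 * k) * - (t/2))"
    by (simp add: cis_mult algebra_simps)
  also have "\<dots> = cis (t/2) ^ L * cis (- (t/2)) ^ (2 * k)"
    by (simp only: Complex.DeMoivre)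
  finally show ?thesis
    by (simp add: torus_weight_def expZ_3_entries matrix_matrix_mult_def sum_2 power_mult_distrib)
qed

lemma partial0_torus_weight:
  "partial0 (torus_weight L k) x = \<i> * complex_of_real (real L / 2 - real k) * torus_weight L k x"
proof (rule lider_eqI)
  have "((\<lambda>t. cis ((real L / 2 - real k) * t)) has_vector_derivative
      \<i> * complex_of_real (real L / 2 - real k)) (at 0)"
    unfolding has_vector_derivative_def
    by (auto intro!: derivative_eq_intros simp: scaleR_conv_of_real)
  then show "((\<lambda>t. torus_weight L k (x ** expZ 3 t)) has_vector_derivative
      \<i> * complex_of_real (real L / 2 - real k) * torus_weight L k x) (at 0)"
    unfolding torus_weight_mult_expZ by (rule has_vector_derivative_mult_left)
qed

lemma Delta_eq_0_coefficients:
  assumes "p \<noteq> 0" "Delta p q m = 0"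
  obtains \<alpha> \<beta> where "\<alpha> + \<beta> \<noteq> 0" "\<i> * m * \<alpha> = q * \<alpha> + p * cnj \<beta>" "- \<i> * m * \<beta> = q * \<beta> + p * cnj \<alpha>"
proof -
  define \<gamma> where "\<gamma> = \<i> * m - q"
  have \<gamma>: "\<gamma> * (\<i> * m - cnj q) = p * cnj p"
    using \<open>Delta p q m = 0\<close> by (simp add: Delta_eq_determinant \<gamma>_def)
  have coefficients: "\<i> * m * (s * p) = q * (s * p) + p * cnj (cnj (s * \<gamma>))"
    "- \<i> * m * cnj (s * \<gamma>) = q * cnj (s * \<gamma>) + p * cnj (s * p)" for s
  proof -
    show "\<i> * m * (s * p) = q * (s * p) + p * cnj (cnj (s * \<gamma>))"
      by (simp add: \<gamma>_def algebra_simps)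
    have "cnj (s * (\<gamma> * (\<i> * m - cnj q))) = cnj (s * (p * cnj p))"
      by (simp only: \<gamma>)
    then show "- \<i> * m * cnj (s * \<gamma>) = q * cnj (s * \<gamma>) + p * cnj (s * p)"
      by (simp add: algebra_simps)
  qed
  have "2 * p = (1 * p + cnj (1 * \<gamma>)) - \<i> * (\<i> * p + cnj (\<i> * \<gamma>))"
    by (simp add: algebra_simps)
  then have "1 * p + cnj (1 * \<gamma>) \<noteq> 0 \<or> \<i> * p + cnj (\<i> * \<gamma>) \<noteq> 0"
    using \<open>p \<noteq> 0\<close> by (metis diff_zero mult_eq_0_iff zero_neq_numeral)
  then obtain s where "s * p + cnj (s * \<gamma>) \<noteq> 0"
    by blast
  then show thesis
    using coefficients[of s] by (rule that)
qed

lemma Pop_smooth_solution: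
  assumes "p \<noteq> 0" "Delta p q (real L / 2 - real k) = 0"
  obtains w where "smooth_su2 w" "w (mat 1) \<noteq> 0"
    "\<And>x. x \<in> SU2 \<Longrightarrow> partial0_minus q w x = p * cnj (w x)"
proof -
  define m where "m = real L / 2 - real k"
  obtain \<alpha> \<beta> where "\<alpha> + \<beta> \<noteq> 0"
    and coefficients: "\<i> * m * \<alpha> = q * \<alpha> + p * cnj \<beta>" "- \<i> * m * \<beta> = q * \<beta> + p * cnj \<alpha>"
    using assms unfolding m_def[symmetric] by (rule Delta_eq_0_coefficients)
  define w where "w x = \<alpha> * torus_weight L k x + \<beta> * cnj (torus_weight L k x)" for x
  have "partial0_minus q w x = p * cnj (w x)" if x: "x \<in> SU2" for x
  proof -
    have "partial0 w x = (\<i> * m * \<alpha>) * torus_weight L k x + (- \<i> * m * \<beta>) * cnj (torus_weight L k x)"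
      unfolding w_def
      by (simp add: lider_add lider_cmult lider_cnj smooth_su2_intros smooth_su2_torus_weight x
          partial0_torus_weight m_def)
    then show ?thesis
      unfolding coefficients by (simp add: partial0_minus_def w_def algebra_simps)
  qed
  moreover have "smooth_su2 w"
    unfolding w_def by (intro smooth_su2_intros smooth_su2_torus_weight)
  moreover have "w (mat 1) \<noteq> 0"
    using \<open>\<alpha> + \<beta> \<noteq> 0\<close> by (simp add: w_def torus_weight_def mat_def)
  ultimately show thesis using that by blast
qed

theorem not_globally_hypoelliptic_Pop_if_Delta_zero:
  assumes "p \<noteq> 0" "Delta p q (real L / 2 - real k) = 0"
  shows "\<not> globally_hypoelliptic (Pop p q)"
proof -
  obtain w where w: "smooth_su2 w" "w (mat 1) \<noteq> 0"
      "\<And>x. x \<in> SU2 \<Longrightarrow> partial0_minus q w x = p * cnj (w x)"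
    using Pop_smooth_solution[OF assms] by blast
  define u where "u \<phi> = torus_int (\<lambda>x. w x * \<phi> x)" for \<phi>
  have u: "torus.has_density u w"
    by (simp add: u_def torus.has_densityI)
  have "torus.has_density (Pop p q u) (\<lambda>x. partial0_minus q w x + - p * cnj (w x))"
    using torus.has_density_dpartial0_minus_add_dconj[OF u w(1) u w(1), of q "- p"]
    by (simp add: Pop_eq[abs_def])
  then have "Pop p q u \<phi> = haar_int (\<lambda>x. 0 * \<phi> x)" if "smooth_su2 \<phi>" for \<phi>
    using that by (simp add: torus.has_densityD torus_int_def w(3) expZ_in_SU2 haar_int_def)
  then have "smooth_dist (Pop p q u)"
    unfolding smooth_dist_def using smooth_su2_const by blast
  moreover have "is_dist u" "\<not> smooth_dist u"
    unfolding u_def using w by (simp_all add: is_dist_torus_density not_smooth_dist_torus_density)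
  ultimately show ?thesis
    unfolding globally_hypoelliptic_def by blast
qed

lemma half_integer_weight:
  fixes n :: int
  obtains L k :: nat where "k \<le> L" "real L / 2 - real k = of_int n / 2"
proof (cases "n \<ge> 0")
  case True
  then show thesis using that[of 0 "nat n"] by simp
next
  case False
  then show thesis using that[of "nat (- n)" "nat (- n)"] by (simp add: field_simps)
qed

theorem theorem5p3:
  fixes p q :: complex
  assumes "p \<noteq> 0"
  shows "globally_hypoelliptic (Pop p q) \<longleftrightarrow>
    (\<forall>(L::nat) (k::nat). k \<le> L \<longrightarrow>
       (let l = real L / 2; m = l - real k in
          - (complex_of_real m)\<^sup>2 + (complex_of_real (cmod q))\<^sup>2 - (complex_of_real (cmod p))\<^sup>2
          - 2 * \<i> * complex_of_real m * complex_of_real (Re q) \<noteq> 0))"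
  unfolding Let_def Delta_def[symmetric]
proof
  assume "globally_hypoelliptic (Pop p q)"
  then show "\<forall>L k. k \<le> L \<longrightarrow> Delta p q (real L / 2 - real k) \<noteq> 0"
    using not_globally_hypoelliptic_Pop_if_Delta_zero[OF assms] by blast
next
  assume nonzero: "\<forall>L k. k \<le> L \<longrightarrow> Delta p q (real L / 2 - real k) \<noteq> 0"
  show "globally_hypoelliptic (Pop p q)"
  proof (rule globally_hypoelliptic_Pop_if_Delta_nonzero)
    show "Delta p q (of_int n / 2) \<noteq> 0" for n :: int
      using nonzero half_integer_weight[of n] by metis
  qed
qed

end
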